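(* Let $R$ be a commutative $\mathbb{Q}$-algebra, let $m\ge 1$ be an integer, $n=2m$, and let $A\in\mathrm{Mat}(n,R)$ be skew-symmetric. Let $J\in\mathrm{Mat}(n,R)$ be the block-diagonal matrix with $m$ diagonal blocks equal to $\begin{pmatrix}0&1\\-1&0\end{pmatrix}$. Set $c_0=1$ and define matrices $N_1,\dots,N_m\in\mathrm{Mat}(n,R)$ and elements $c_1,\dots,c_m\in R$ recursively by $$N_1=-J,\qquad c_k=\tfrac{1}{2k}\,\mathrm{tr}(AN_k)\quad (1\le k\le m),\qquad N_{k+1}=JAN_k-c_k\,J\quad (1\le k\le m-1).$$ Then, in $R[t]$, $$\mathrm{pf}(tJ+A)=\sum_{j=0}^{m}c_{m-j}\,t^j .$$ In particular $c_m=\mathrm{pf}(A)$. Moreover $N_m=\mathrm{Padj}(A)$ and $A\,N_m=\mathrm{pf}(A)\cdot I$. Consequently, if $\beta\ge 2$ is such that two $n\times n$-matrices over $R$ can be multiplied at cost $O(n^\beta)$, then this recursion computes the Pfaffian of a skew-symmetric $n\times n$-matrix over $R$ ($n$ even) at cost $O(n^{\beta+1})$, and the only divisions it uses are divisions by the nonzero integers $2k$, $1\le k\le m$ (no divisions by matrix entries).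
   Context: A matrix $A$ is skew-symmetric if $A^\top=-A$. (Over a $\mathbb{Q}$-algebra this forces zero diagonal.) $I$ is the $n\times n$ identity matrix. Pfaffian: for a commutative $\mathbb{Q}$-algebra $S$ (here $S=R$ or $S=R[t]$) and a skew-symmetric matrix $A=(a_{ij})\in\mathrm{Mat}(n,S)$ with $n=2m$, $$\mathrm{pf}(A)=\sum_P \mathrm{sign}(P)\,a_{i_1j_1}\cdots a_{i_mj_m},$$ where the sum is over all perfect matchings $P$ of $\{1,\dots,n\}$, i.e. partitions $\{1,\dots,n\}=\{i_1,j_1\}\sqcup\cdots\sqcup\{i_m,j_m\}$ into two-element sets, written with $i_k<j_k$, and $\mathrm{sign}(P)$ is the sign of the permutation sending $(1,2,\dots,n-1,n)$ to $(i_1,j_1,\dots,i_m,j_m)$. The Pfaffian of the empty ($0\times0$) matrix is $1$. Pfaff-adjugate: for $i\ne j$ let $A\langle i,j\rangle$ be the skew-symmetric $(n-2)\times(n-2)$-matrix obtained from $A$ by removing the $i$-th and $j$-th rows and columns. Then $\mathrm{Padj}(A)=(b_{ij})\in\mathrm{Mat}(n,S)$ is defined by $b_{ii}=0$, $b_{ij}=(-1)^{i+j}\,\mathrm{pf}(A\langle i,j\rangle)$ if $i<j$, and $b_{ij}=(-1)^{i+j+1}\,\mathrm{pf}(A\langle i,j\rangle)$ if $i>j$. Cost means the number of arithmetic operations in $R$: additions, subtractions, multiplications, and divisions by nonzero integers. *)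

theory Defs
  imports
    "Jordan_Normal_Form.Matrix"
    "Jordan_Normal_Form.DL_Submatrix"
    "HOL-Combinatorics.Permutations"
    "HOL-Computational_Algebra.Polynomial"
    "HOL-Library.Disjoint_Sets"
    "HOL-Library.Landau_Symbols"
begin

section \<open>Commutative algebras over the rationals\<close>

class comm_rat_algebra = comm_ring_1 +
  fixes scaleQ :: "rat \<Rightarrow> 'a \<Rightarrow> 'a"  (infixr \<open>*\<^sub>Q\<close> 75)
  assumes scaleQ_add_right: "q *\<^sub>Q (x + y) = q *\<^sub>Q x + q *\<^sub>Q y"
    and scaleQ_add_left: "(q + r) *\<^sub>Q x = q *\<^sub>Q x + r *\<^sub>Q x"
    and scaleQ_scaleQ: "q *\<^sub>Q (r *\<^sub>Q x) = (q * r) *\<^sub>Q x"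
    and scaleQ_one: "1 *\<^sub>Q x = x"
    and mult_scaleQ_left: "(q *\<^sub>Q x) * y = q *\<^sub>Q (x * y)"


section \<open>Pfaffian and Pfaff-adjugate\<close>

definition skew_symmetric :: "'a::uminus mat \<Rightarrow> bool" where
  "skew_symmetric A \<longleftrightarrow> transpose_mat A = - A"

definition mat_trace :: "'a::comm_monoid_add mat \<Rightarrow> 'a" where
  "mat_trace A = (\<Sum>i<dim_row A. A $$ (i, i))"

text \<open>Rows and columns are indexed from 0, so matchings are matchings of
  \<open>{0, \<dots>, n - 1}\<close>. A shift of both indices by 1 does not change any sign below.\<close>

definition perfect_matchings :: "nat \<Rightarrow> nat set set set" where
  "perfect_matchings n = {P. partition_on {..<n} P \<and> (\<forall>e\<in>P. card e = 2)}"

text \<open>The permutations sending \<open>(0, 1, \<dots>, n-2, n-1)\<close> to \<open>(i\<^sub>1, j\<^sub>1, \<dots>, i\<^sub>m, j\<^sub>m)\<close>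
  with \<open>i\<^sub>k < j\<^sub>k\<close>, where the pairs of the matching may be listed in any order. The sign
  does not depend on that order, since exchanging two pairs is an even permutation.\<close>

definition enumerates_matching :: "nat \<Rightarrow> nat set set \<Rightarrow> (nat \<Rightarrow> nat) \<Rightarrow> bool" where
  "enumerates_matching n P \<sigma> \<longleftrightarrow>
     \<sigma> permutes {..<n} \<and>
     (\<forall>k<n div 2. \<sigma> (2 * k) < \<sigma> (2 * k + 1)) \<and>
     P = (\<lambda>k. {\<sigma> (2 * k), \<sigma> (2 * k + 1)}) ` {..<n div 2}"

definition matching_sign :: "nat \<Rightarrow> nat set set \<Rightarrow> int" where
  "matching_sign n P = sign (SOME \<sigma>. enumerates_matching n P \<sigma>)"

definition pfaffian :: "'a::comm_ring_1 mat \<Rightarrow> 'a" where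
  "pfaffian A =
     (\<Sum>P\<in>perfect_matchings (dim_row A).
        of_int (matching_sign (dim_row A) P) * (\<Prod>e\<in>P. A $$ (Min e, Max e)))"

definition remove_two :: "'a mat \<Rightarrow> nat \<Rightarrow> nat \<Rightarrow> 'a mat" where
  "remove_two A i j = submatrix A (- {i, j}) (- {i, j})"

definition pfaff_adjugate :: "'a::comm_ring_1 mat \<Rightarrow> 'a mat" where
  "pfaff_adjugate A = mat (dim_row A) (dim_col A) (\<lambda>(i, j).
     if i = j then 0
     else if i < j then (-1) ^ (i + j) * pfaffian (remove_two A i j)
     else (-1) ^ (i + j + 1) * pfaffian (remove_two A i j))"

definition J_mat :: "nat \<Rightarrow> 'a::ring_1 mat" where
  "J_mat m = diag_block_mat (replicate m (mat_of_rows_list 2 [[0, 1], [-1, 0]]))"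


section \<open>Straight-line programs and their cost\<close>

text \<open>The target register is the first argument. Loading a constant and copying
  a register perform no arithmetic and are free.\<close>

datatype ('a, 'v) instr =
    Const 'v 'a
  | Copy 'v 'v
  | Add 'v 'v 'v
  | Sub 'v 'v 'v
  | Mul 'v 'v 'v
  | DivInt 'v 'v int

primrec exec_instr :: "('a::comm_rat_algebra, 'v) instr \<Rightarrow> ('v \<Rightarrow> 'a) \<Rightarrow> 'v \<Rightarrow> 'a" where
  "exec_instr (Const x a) s = s(x := a)"
| "exec_instr (Copy x y) s = s(x := s y)"
| "exec_instr (Add x y z) s = s(x := s y + s z)"
| "exec_instr (Sub x y z) s = s(x := s y - s z)"
| "exec_instr (Mul x y z) s = s(x := s y * s z)"
| "exec_instr (DivInt x y d) s = s(x := (1 / of_int d) *\<^sub>Q s y)"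

definition exec :: "('a::comm_rat_algebra, 'v) instr list \<Rightarrow> ('v \<Rightarrow> 'a) \<Rightarrow> 'v \<Rightarrow> 'a" where
  "exec p s = fold exec_instr p s"

primrec instr_cost :: "('a, 'v) instr \<Rightarrow> nat" where
  "instr_cost (Const x a) = 0"
| "instr_cost (Copy x y) = 0"
| "instr_cost (Add x y z) = 1"
| "instr_cost (Sub x y z) = 1"
| "instr_cost (Mul x y z) = 1"
| "instr_cost (DivInt x y d) = 1"

definition cost :: "('a, 'v) instr list \<Rightarrow> nat" where
  "cost p = sum_list (map instr_cost p)"

definition no_zero_division :: "('a, 'v) instr list \<Rightarrow> bool" where
  "no_zero_division p \<longleftrightarrow> (\<forall>x y. DivInt x y 0 \<notin> set p)"

definition holds :: "('v \<Rightarrow> 'a) \<Rightarrow> (nat \<Rightarrow> nat \<Rightarrow> 'v) \<Rightarrow> 'a mat \<Rightarrow> bool" where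
  "holds s X B \<longleftrightarrow> (\<forall>i<dim_row B. \<forall>j<dim_col B. s (X i j) = B $$ (i, j))"

datatype mulreg = LeftIn nat nat | RightIn nat nat | ProdOut nat nat | Tmp nat

text \<open>The registers other than the inputs start with arbitrary contents, so they
  carry no free information.\<close>

definition computes_product :: "nat \<Rightarrow> ('a::comm_rat_algebra, mulreg) instr list \<Rightarrow> bool" where
  "computes_product n p \<longleftrightarrow> no_zero_division p \<and>
     (\<forall>B\<in>carrier_mat n n. \<forall>C\<in>carrier_mat n n. \<forall>s.
        holds s LeftIn B \<and> holds s RightIn C \<longrightarrow> holds (exec p s) ProdOut (B * C))"


section \<open>The recursion as a program\<close>

datatype pfreg =
    RegA nat nat
  | RegJ nat nat
  | RegN nat nat
  | RegAN nat nat
  | RegJAN nat nat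
  | RegC nat
  | RegT
  | RegMul mulreg  \<comment> \<open>workspace of the multiplication subroutine\<close>

definition for_entries :: "nat \<Rightarrow> (nat \<Rightarrow> nat \<Rightarrow> 'b list) \<Rightarrow> 'b list" where
  "for_entries n f = concat [f i j. i \<leftarrow> [0..<n], j \<leftarrow> [0..<n]]"

definition call_product ::
  "('a, mulreg) instr list \<Rightarrow> nat \<Rightarrow> (nat \<Rightarrow> nat \<Rightarrow> pfreg) \<Rightarrow> (nat \<Rightarrow> nat \<Rightarrow> pfreg)
    \<Rightarrow> (nat \<Rightarrow> nat \<Rightarrow> pfreg) \<Rightarrow> ('a, pfreg) instr list" where
  "call_product p n X Y Z =
     for_entries n (\<lambda>i j. [Copy (RegMul (LeftIn i j)) (X i j),
                           Copy (RegMul (RightIn i j)) (Y i j)])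
     @ map (map_instr id RegMul) p
     @ for_entries n (\<lambda>i j. [Copy (Z i j) (RegMul (ProdOut i j))])"

definition coeff_step :: "('a::zero, mulreg) instr list \<Rightarrow> nat \<Rightarrow> nat \<Rightarrow> ('a, pfreg) instr list" where
  "coeff_step p n k =
     call_product p n RegA RegN RegAN
     @ [Const RegT 0]
     @ [Add RegT RegT (RegAN i i). i \<leftarrow> [0..<n]]
     @ [DivInt (RegC k) RegT (2 * int k)]"

definition matrix_step :: "('a, mulreg) instr list \<Rightarrow> nat \<Rightarrow> nat \<Rightarrow> ('a, pfreg) instr list" where
  "matrix_step p n k =
     call_product p n RegJ RegAN RegJAN
     @ for_entries n (\<lambda>i j. [Mul RegT (RegC k) (RegJ i j),
                             Sub (RegN i j) (RegJAN i j) RegT])"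

text \<open>Here \<open>p\<close> is the subroutine used to multiply \<open>2m \<times> 2m\<close> matrices. The input is
  read from the registers \<open>RegA i j\<close>, the output is left in \<open>RegC m\<close>.\<close>

definition pfaffian_prog ::
  "('a::comm_rat_algebra, mulreg) instr list \<Rightarrow> nat \<Rightarrow> ('a, pfreg) instr list" where
  "pfaffian_prog p m =
     for_entries (2 * m) (\<lambda>i j. [Const (RegJ i j) (J_mat m $$ (i, j)),
                                 Const (RegN i j) ((- J_mat m) $$ (i, j))])
     @ [Const (RegC 0) 1]
     @ concat [coeff_step p (2 * m) k
               @ (if k < m then matrix_step p (2 * m) k else []). k \<leftarrow> [1..<m + 1]]"

definition computes_pfaffian ::
  "nat \<Rightarrow> ('a::comm_rat_algebra, pfreg) instr list \<Rightarrow> bool" where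
  "computes_pfaffian m p \<longleftrightarrow> no_zero_division p \<and>
     (\<forall>A\<in>carrier_mat (2 * m) (2 * m). \<forall>s.
        skew_symmetric A \<and> holds s RegA A \<longrightarrow> exec p s (RegC m) = pfaffian A)"

end

theory Submission
  imports Defs "Jordan_Normal_Form.Determinant"
begin

text \<open>
  Over a ring without torsion the matching sum can be replaced by the sum over all permutations of
  \<open>sign \<sigma> \<Prod>\<^sub>k A (\<sigma> (2k), \<sigma> (2k+1))\<close>, which is \<open>2\<^sup>m m!\<close> times the Pfaffian. Distinguishing one
  pair in that sum and fixing its two values produces the entries of the Pfaff-adjugate. This single
  expansion yields both \<open>B Padj(B) = pf(B) I\<close> (an off-diagonal entry is the Pfaffian of a matrix
  with two equal rows and columns) and the derivative formula
  \<open>2 (d/dt) pf(tJ + A) = tr (J Padj(tJ + A))\<close>.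

  Write \<open>M\<^sub>s\<close> and \<open>p\<^sub>s\<close> for the coefficients of \<open>t\<^sup>s\<close> in \<open>Padj(tJ + A)\<close> and \<open>pf(tJ + A)\<close>. The first
  identity reads \<open>A M\<^sub>s + J M\<^sub>s\<^sub>-\<^sub>1 = p\<^sub>s I\<close>; as \<open>J\<^sup>2 = -I\<close> this is the matrix recursion, starting from
  \<open>M\<^sub>m = 0\<close> and \<open>p\<^sub>m = pf(J) = 1\<close>. Taking traces and inserting \<open>tr (J M\<^sub>s\<^sub>-\<^sub>1) = 2 s p\<^sub>s\<close> gives
  \<open>tr (A M\<^sub>s) = 2 (m - s) p\<^sub>s\<close>. Hence \<open>N\<^sub>k = M\<^sub>m\<^sub>-\<^sub>k\<close> and \<open>c\<^sub>k = p\<^sub>m\<^sub>-\<^sub>k\<close>.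
\<close>

text \<open>The ring R may have zero divisors and A need not be invertible, so Padj cannot be
  obtained as pf(A) times an inverse, and the identities have to come from the defining sum. There
  the sign of a matching is the sign of a chosen enumeration, which gives little control when a pair
  is removed. The permutation sum involves no choice, and its signs multiply under reindexing; the
  price is the factor 2^m m!, to be cancelled afterwards. Cancellation is based on absence of
  torsion rather than on rational scalars: this is a property, it passes coefficientwise from R to
  R[t], and so the same lemmas apply to A and to tJ + A. Actual division enters only where c_k is
  recovered from a trace equal to 2k c_k.\<close>

section \<open>The Pfaffian as a sum over permutations\<close>

text \<open>Moves the pair \<open>{2k, 2k+1}\<close> to position \<open>\<pi> k\<close>, swapping its elements if \<open>k \<in> S\<close>: the
  reorderings that leave the enumerated matching unchanged.\<close>
definition pair_perm :: "(nat \<Rightarrow> nat) \<Rightarrow> nat set \<Rightarrow> nat \<Rightarrow> nat" where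
  "pair_perm \<pi> S x = 2 * \<pi> (x div 2) + (if x div 2 \<in> S then 1 - x mod 2 else x mod 2)"

lemma pair_perm_even [simp]: "pair_perm \<pi> S (2 * k) = 2 * \<pi> k + (if k \<in> S then 1 else 0)"
  and pair_perm_odd [simp]: "pair_perm \<pi> S (Suc (2 * k)) = 2 * \<pi> k + (if k \<in> S then 0 else 1)"
  by (simp_all add: pair_perm_def)

lemma nat_even_odd_ext:
  assumes "\<And>k. f (2 * k) = g (2 * k)" "\<And>k. f (Suc (2 * k)) = g (Suc (2 * k))"
  shows "f = (g :: nat \<Rightarrow> 'b)"
proof
  fix x show "f x = g x"
    by (cases "even x") (auto elim!: evenE oddE simp: assms)
qed

lemma pair_perm_permutes:
  assumes "\<pi> permutes {..<m}" "S \<subseteq> {..<m}"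
  shows "pair_perm \<pi> S permutes {..<2 * m}"
proof (rule inj_imp_permutes)
  show "inj_on (pair_perm \<pi> S) {..<2 * m}"
  proof (rule inj_onI)
    fix x y assume eq: "pair_perm \<pi> S x = pair_perm \<pi> S y"
    have "pair_perm \<pi> S z div 2 = \<pi> (z div 2)" for z by (simp add: pair_perm_def)
    then have "\<pi> (x div 2) = \<pi> (y div 2)" using eq by metis
    then have d: "x div 2 = y div 2" using permutes_inj[OF assms(1)] by (auto dest: injD)
    with eq have "x mod 2 = y mod 2" by (auto simp: pair_perm_def split: if_splits)
    with d show "x = y" by (metis div_mult_mod_eq)
  qed
  show "pair_perm \<pi> S x \<in> {..<2 * m}" if "x \<in> {..<2 * m}" for x
  proof -
    have "x div 2 < m" using that by auto
    then have "\<pi> (x div 2) < m" using permutes_in_image[OF assms(1), of "x div 2"] by auto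
    then show ?thesis by (auto simp: pair_perm_def)
  qed
  show "pair_perm \<pi> S x = x" if "x \<notin> {..<2 * m}" for x
  proof -
    have "\<not> x div 2 < m" using that by auto
    then have "\<pi> (x div 2) = x div 2" "x div 2 \<notin> S"
      using permutes_not_in[OF assms(1), of "x div 2"] assms(2) by auto
    then show ?thesis by (simp add: pair_perm_def)
  qed
qed auto

lemma pair_perm_transpose:
  "pair_perm (transpose a b) {} = transpose (2 * a) (2 * b) \<circ> transpose (Suc (2 * a)) (Suc (2 * b))"
  by (rule nat_even_odd_ext)
    (auto simp: transpose_def double_not_eq_Suc_double Suc_double_not_eq_double)

lemma pair_perm_id_empty: "pair_perm (\<lambda>x. x) {} = id"
  by (rule nat_even_odd_ext) auto

text \<open>Write \<pi> as a product of transpositions: each transposition of pairs is a product of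
  two transpositions of elements, hence even.\<close>

lemma sign_pair_perm_empty:
  assumes "\<pi> permutes {..<m}"
  shows "sign (pair_perm \<pi> {}) = 1"
  using assms finite_lessThan
proof (induction rule: permutes_induct)
  case id
  show ?case by (simp add: pair_perm_id_empty id_def)
next
  case (swap a b p)
  have "pair_perm (transpose a b \<circ> p) {} = pair_perm (transpose a b) {} \<circ> pair_perm p {}"
    by (rule nat_even_odd_ext) (simp_all add: o_def)
  moreover have "permutation (pair_perm p {})"
    using pair_perm_permutes[OF swap(4), of "{}"] permutes_imp_permutation[OF finite_lessThan] by blast
  moreover have "sign (pair_perm (transpose a b) {}) = 1"
    using swap(3) by (simp add: pair_perm_transpose sign_compose permutation_swap_id sign_swap_id)
  moreover have "permutation (pair_perm (transpose a b) {})"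
    by (simp add: pair_perm_transpose permutation_compose permutation_swap_id)
  ultimately show ?case using swap by (simp add: sign_compose del: o_apply)
qed

text \<open>Each flipped pair contributes one transposition. That the map is a permutation is
  carried along because multiplicativity of \<open>sign\<close> requires it.\<close>

lemma sign_pair_perm_id:
  assumes "finite S"
  shows "sign (pair_perm (\<lambda>x. x) S) = (-1) ^ card S \<and> permutation (pair_perm (\<lambda>x. x) S)"
  using assms
proof (induction rule: finite_induct)
  case empty
  show ?case by (simp add: pair_perm_id_empty)
next
  case (insert a S)
  have "pair_perm (\<lambda>x. x) (insert a S) = transpose (2 * a) (Suc (2 * a)) \<circ> pair_perm (\<lambda>x. x) S"
    using insert(2) 
    by (intro nat_even_odd_ext)
      (auto simp: transpose_def double_not_eq_Suc_double Suc_double_not_eq_double)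
  then show ?case
    using insert permutation_swap_id[of "2 * a" "Suc (2 * a)"]
    by (simp add: sign_compose permutation_compose sign_swap_id del: o_apply)
qed

lemma sign_pair_perm:
  assumes "\<pi> permutes {..<m}" "S \<subseteq> {..<m}"
  shows "sign (pair_perm \<pi> S) = (-1) ^ card S"
proof -
  \<comment> \<open>First flip inside the pairs, then move whole pairs.\<close>
  have "pair_perm \<pi> S = pair_perm \<pi> {} \<circ> pair_perm (\<lambda>x. x) S"
    by (rule nat_even_odd_ext) (simp_all add: pair_perm_def)
  moreover have "permutation (pair_perm \<pi> {})"
    using pair_perm_permutes[OF assms(1), of "{}"] permutes_imp_permutation[OF finite_lessThan] by blast
  moreover have "finite S" using assms(2) finite_subset by blast
  ultimately show ?thesis
    using sign_pair_perm_id[of S] sign_pair_perm_empty[OF assms(1)] by (simp add: sign_compose)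
qed

section \<open>Perfect matchings and the permutations that list them\<close>

definition matching_of :: "nat \<Rightarrow> (nat \<Rightarrow> nat) \<Rightarrow> nat set set" where
  "matching_of m \<sigma> = (\<lambda>k. {\<sigma> (2 * k), \<sigma> (2 * k + 1)}) ` {..<m}"

lemma permutes_pair_neq:
  fixes \<sigma> :: "nat \<Rightarrow> nat"
  assumes "\<sigma> permutes A"
  shows "\<sigma> (2 * k) \<noteq> \<sigma> (Suc (2 * l))"
  by (metis assms double_not_eq_Suc_double permutes_inj injD)

lemma inj_matching_of:
  fixes \<sigma> :: "nat \<Rightarrow> nat"
  assumes "\<sigma> permutes A"
  shows "inj (\<lambda>k. {\<sigma> (2 * k), \<sigma> (2 * k + 1)})"
proof (rule injI)
  fix x y
  assume "{\<sigma> (2 * x), \<sigma> (2 * x + 1)} = {\<sigma> (2 * y), \<sigma> (2 * y + 1)}"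
  then have "\<sigma> (2 * x) \<in> {\<sigma> (2 * y), \<sigma> (2 * y + 1)}" by blast
  then show "x = y" using permutes_pair_neq[OF assms] permutes_inj[OF assms]
    by (auto simp: inj_eq)
qed

lemma matching_of_perfect:
  assumes "\<sigma> permutes {..<2 * m}"
  shows "matching_of m \<sigma> \<in> perfect_matchings (2 * m)"
proof -
  have "\<Union> (matching_of m \<sigma>) = \<sigma> ` (\<Union>k<m. {2 * k, 2 * k + 1})"
    by (auto simp: matching_of_def)
  also have "(\<Union>k<m. {2 * k, 2 * k + 1}) = {..<2 * m}"
  proof (intro equalityI subsetI)
    fix x assume "x \<in> {..<2 * m}"
    then have "x div 2 < m" "x = 2 * (x div 2) \<or> x = 2 * (x div 2) + 1" by auto
    then show "x \<in> (\<Union>k<m. {2 * k, 2 * k + 1})" by blast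
  qed auto
  finally have "\<Union> (matching_of m \<sigma>) = {..<2 * m}" using permutes_image[OF assms] by simp
  moreover have "disjoint (matching_of m \<sigma>)"
    using permutes_pair_neq[OF assms] permutes_pair_neq[OF assms, symmetric] permutes_inj[OF assms]
    by (auto simp: matching_of_def disjoint_def inj_eq)
  moreover have "\<forall>e\<in>matching_of m \<sigma>. card e = 2"
    using permutes_pair_neq[OF assms] by (auto simp: matching_of_def)
  moreover have "{} \<notin> matching_of m \<sigma>" by (auto simp: matching_of_def)
  ultimately show ?thesis by (auto simp: perfect_matchings_def partition_on_def)
qed

lemma Min_less_Max_of_card_2:
  assumes "card (e :: nat set) = 2"
  shows "Min e < Max e" "e = {Min e, Max e}"
proof -
  from assms obtain x y where "e = {x, y}" "x \<noteq> y" by (auto simp: card_2_iff)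
  then show "Min e < Max e" "e = {Min e, Max e}" by (auto simp: min_def max_def)
qed

text \<open>Without a witness the \<open>SOME\<close> in \<open>matching_sign\<close> would be
  arbitrary. List the pairs in any order, the minimum of each at the even and the maximum at the odd
  position.\<close>

lemma enumerates_matching_exists:
  assumes P: "P \<in> perfect_matchings (2 * m)"
  shows "\<exists>\<sigma>. enumerates_matching (2 * m) P \<sigma>"
proof -
  have part: "partition_on {..<2 * m} P" and c2: "\<And>e. e \<in> P \<Longrightarrow> card e = 2"
    using P by (auto simp: perfect_matchings_def)
  have fin: "finite P" using finite_elements[OF _ part] by simp
  have un: "\<Union> P = {..<2 * m}" using partition_onD1[OF part] by simp
  have dj: "disjoint P" using partition_onD2[OF part] .
  have fe: "finite e" if "e \<in> P" for e using c2[OF that] by (metis card.infinite zero_neq_numeral)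
  \<comment> \<open>Counting elements pair by pair yields the number of pairs, and with it an
    indexing of \<open>P\<close> by \<open>{..<m}\<close>.\<close>
  have "2 * m = card (\<Union> P)" by (simp add: un)
  also have "\<dots> = (\<Sum>e\<in>P. card e)"
    using dj fe by (intro card_Union_disjoint) (auto simp: disjoint_def pairwise_def disjnt_def)
  also have "\<dots> = 2 * card P" using c2 by simp
  finally have "card P = m" by simp
  then obtain f where f: "bij_betw f {..<m} P"
    using ex_bij_betw_nat_finite[OF fin] by (auto simp: atLeast0LessThan)
  define \<sigma> where "\<sigma> x = (if x < 2 * m then if even x then Min (f (x div 2)) else Max (f (x div 2)) else x)" for x
  have fP: "f k \<in> P" if "k < m" for k using f that by (auto simp: bij_betw_def)
  have ev: "\<sigma> (2 * k) = Min (f k)" "\<sigma> (2 * k + 1) = Max (f k)" if "k < m" for k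
    using that by (auto simp: \<sigma>_def)
  have pair: "{\<sigma> (2 * k), \<sigma> (2 * k + 1)} = f k" if "k < m" for k
    using Min_less_Max_of_card_2(2)[OF c2[OF fP[OF that]]] ev[OF that] by simp
  have "\<sigma> permutes {..<2 * m}"
  proof (rule bij_imp_permutes)
    \<comment> \<open>Surjectivity suffices: on a finite set it implies injectivity.\<close>
    have img: "\<sigma> ` {..<2 * m} = {..<2 * m}"
    proof (intro equalityI subsetI)
      fix y assume "y \<in> {..<2 * m}"
      then obtain e where "e \<in> P" "y \<in> e" using un by blast
      then obtain k where k: "k < m" "y \<in> f k" using f by (auto simp: bij_betw_def)
      then have "y \<in> {\<sigma> (2 * k), \<sigma> (2 * k + 1)}" using pair by blast
      moreover have "2 * k \<in> {..<2*m}" "2 * k + 1 \<in> {..<2*m}" using k by auto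
      ultimately show "y \<in> \<sigma> ` {..<2 * m}" by blast
    next
      fix y assume "y \<in> \<sigma> ` {..<2 * m}"
      then obtain x where x: "x < 2 * m" "y = \<sigma> x" by auto
      define k where "k = x div 2"
      have k: "k < m" "x = 2 * k \<or> x = 2 * k + 1" using x by (auto simp: k_def)
      then have "y \<in> f k" using pair[of k] x by blast
      then show "y \<in> {..<2 * m}" using fP[of k] k un by blast
    qed
    then show "bij_betw \<sigma> {..<2 * m} {..<2 * m}"
      by (simp add: bij_betw_def eq_card_imp_inj_on)
  qed (auto simp: \<sigma>_def)
  moreover have "\<forall>k<m. \<sigma> (2 * k) < \<sigma> (2 * k + 1)"
    using ev Min_less_Max_of_card_2(1) c2 fP by metis
  moreover have "P = (\<lambda>k. {\<sigma> (2 * k), \<sigma> (2 * k + 1)}) ` {..<m}"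
  proof -
    have "(\<lambda>k. {\<sigma> (2 * k), \<sigma> (2 * k + 1)}) ` {..<m} = f ` {..<m}"
      using pair by (intro image_cong) auto
    then show ?thesis using f by (simp add: bij_betw_def)
  qed
  ultimately show ?thesis by (auto simp: enumerates_matching_def)
qed

text \<open>The choice made inside \<open>matching_sign\<close>, named so that terms of the
  permutation sum can be compared with it.\<close>

definition matching_enum :: "nat \<Rightarrow> nat set set \<Rightarrow> nat \<Rightarrow> nat" where
  "matching_enum n P = (SOME \<sigma>. enumerates_matching n P \<sigma>)"

lemma matching_enum:
  assumes "P \<in> perfect_matchings (2 * m)"
  shows "enumerates_matching (2 * m) P (matching_enum (2 * m) P)"
  unfolding matching_enum_def using someI_ex[OF enumerates_matching_exists[OF assms]] .

lemma matching_enum_permutes: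
  assumes "P \<in> perfect_matchings (2 * m)"
  shows "matching_enum (2 * m) P permutes {..<2 * m}" "matching_of m (matching_enum (2 * m) P) = P"
  using matching_enum[OF assms] by (auto simp: enumerates_matching_def matching_of_def)

lemma matching_of_comp_pair_perm:
  assumes "\<pi> permutes {..<m}"
  shows "matching_of m (\<sigma> \<circ> pair_perm \<pi> S) = matching_of m \<sigma>"
proof -
  have "matching_of m (\<sigma> \<circ> pair_perm \<pi> S) = (\<lambda>k. {\<sigma> (2 * \<pi> k), \<sigma> (2 * \<pi> k + 1)}) ` {..<m}"
    unfolding matching_of_def by (intro image_cong) auto
  also have "\<dots> = (\<lambda>k. {\<sigma> (2 * k), \<sigma> (2 * k + 1)}) ` \<pi> ` {..<m}"
    by (simp add: image_image)
  finally show ?thesis by (simp add: permutes_image[OF assms] matching_of_def)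
qed

text \<open>The fibres of \<open>matching_of\<close> are the orbits of the hyperoctahedral group of
  order 2^m m! acting on positions. This and \<open>pair_perm_inj\<close> make the fibre size
  exact.\<close>

lemma same_matching_imp_pair_perm:
  assumes \<sigma>: "\<sigma> permutes {..<2 * m}" and \<tau>: "\<tau> permutes {..<2 * m}"
    and eq: "matching_of m \<sigma> = matching_of m \<tau>"
  shows "\<exists>\<pi> S. \<pi> permutes {..<m} \<and> S \<subseteq> {..<m} \<and> \<sigma> = \<tau> \<circ> pair_perm \<pi> S"
proof -
  have "\<exists>l<m. {\<sigma> (2 * k), \<sigma> (2 * k + 1)} = {\<tau> (2 * l), \<tau> (2 * l + 1)}" if "k < m" for k
    using eq that unfolding matching_of_def by blast
  then obtain q where q: "\<And>k. k < m \<Longrightarrow> q k < m"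
      "\<And>k. k < m \<Longrightarrow> {\<sigma> (2 * k), \<sigma> (2 * k + 1)} = {\<tau> (2 * q k), \<tau> (2 * q k + 1)}"
    by metis
  define \<pi> where "\<pi> k = (if k < m then q k else k)" for k
  \<comment> \<open>The pairs that the two permutations list in opposite internal order.\<close>
  define S where "S = {k. k < m \<and> \<sigma> (2 * k) \<noteq> \<tau> (2 * q k)}"
  have \<pi>: "\<pi> permutes {..<m}"
  proof (rule inj_imp_permutes)
    show "inj_on \<pi> {..<m}"
    proof (rule inj_onI)
      fix x y assume "x \<in> {..<m}" "y \<in> {..<m}" "\<pi> x = \<pi> y"
      then have "{\<sigma> (2 * x), \<sigma> (2 * x + 1)} = {\<sigma> (2 * y), \<sigma> (2 * y + 1)}"
        using q(2) by (simp add: \<pi>_def)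
      then show "x = y" by (rule injD[OF inj_matching_of[OF \<sigma>]])
    qed
  qed (auto simp: \<pi>_def q)
  have S: "S \<subseteq> {..<m}" by (auto simp: S_def)
  have "\<sigma> = \<tau> \<circ> pair_perm \<pi> S"
  proof
    fix x
    show "\<sigma> x = (\<tau> \<circ> pair_perm \<pi> S) x"
    proof (cases "x < 2 * m")
      case True
      define k where "k = x div 2"
      have k: "k < m" using True by (auto simp: k_def)
      have "x = 2 * k \<or> x = Suc (2 * k)" by (auto simp: k_def)
      then show ?thesis
        using q(2)[OF k] k by (auto simp: S_def \<pi>_def doubleton_eq_iff)
    next
      case False
      then show ?thesis
        using permutes_not_in[OF pair_perm_permutes[OF \<pi> S], of x]
          permutes_not_in[OF \<sigma>, of x] permutes_not_in[OF \<tau>, of x] by simp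
    qed
  qed
  then show ?thesis using \<pi> S by blast
qed

text \<open>The parity of the value at \<open>2 * k\<close> reveals whether k was flipped, and half
  of it, rounded down, reveals where the pair went.\<close>

lemma pair_perm_inj:
  assumes "\<pi> permutes {..<m}" "S \<subseteq> {..<m}" "\<pi>' permutes {..<m}" "S' \<subseteq> {..<m}"
    and eq: "pair_perm \<pi> S = pair_perm \<pi>' S'"
  shows "\<pi> = \<pi>' \<and> S = S'"
proof -
  have "pair_perm \<pi> S (2 * k) = pair_perm \<pi>' S' (2 * k)" for k by (simp add: eq)
  then have e: "2 * \<pi> k + (if k \<in> S then 1 else 0) = 2 * \<pi>' k + (if k \<in> S' then 1 else 0)" for k
    by simp
  have "\<pi> k = \<pi>' k \<and> (k \<in> S \<longleftrightarrow> k \<in> S')" for k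
    using e[of k] by (auto split: if_splits) presburger+
  then show ?thesis by auto
qed

text \<open>The argument is a function rather than a matrix so that relabelled indices, as in
  \<open>pf_perm_sum_permute\<close>, are again an instance.\<close>

definition pf_perm_sum :: "nat \<Rightarrow> (nat \<Rightarrow> nat \<Rightarrow> 'a::comm_ring_1) \<Rightarrow> 'a" where
  "pf_perm_sum m a =
     (\<Sum>\<sigma> | \<sigma> permutes {..<2 * m}. of_int (sign \<sigma>) * (\<Prod>k<m. a (\<sigma> (2 * k)) (\<sigma> (2 * k + 1))))"

text \<open>Every flip changes the sign twice, once in \<open>sign\<close> and once through
  skew-symmetry of the entry; moving whole pairs changes neither the sign nor the product.\<close>

lemma prod_pair_perm:
  fixes a :: "nat \<Rightarrow> nat \<Rightarrow> 'a::comm_ring_1"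
  assumes \<pi>: "\<pi> permutes {..<m}" and S: "S \<subseteq> {..<m}" and \<sigma>: "\<sigma> permutes {..<2 * m}"
    and skew: "\<And>i j. i < 2 * m \<Longrightarrow> j < 2 * m \<Longrightarrow> a j i = - a i j"
  defines "\<tau> \<equiv> \<sigma> \<circ> pair_perm \<pi> S"
  shows "of_int (sign \<tau>) * (\<Prod>k<m. a (\<tau> (2 * k)) (\<tau> (2 * k + 1)))
       = of_int (sign \<sigma>) * (\<Prod>k<m. a (\<sigma> (2 * k)) (\<sigma> (2 * k + 1)))"
proof -
  have lt: "\<sigma> x < 2 * m" if "x < 2 * m" for x using permutes_in_image[OF \<sigma>, of x] that by auto
  have \<pi>lt: "\<pi> k < m" if "k < m" for k using permutes_in_image[OF \<pi>, of k] that by auto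
  have "(\<Prod>k<m. a (\<tau> (2 * k)) (\<tau> (2 * k + 1)))
      = (\<Prod>k<m. (if k \<in> S then -1 else 1) * a (\<sigma> (2 * \<pi> k)) (\<sigma> (2 * \<pi> k + 1)))"
  proof (rule prod.cong[OF refl])
    fix k assume "k \<in> {..<m}"
    then have "\<pi> k < m" using \<pi>lt by auto
    then have "\<sigma> (2 * \<pi> k) < 2 * m" "\<sigma> (2 * \<pi> k + 1) < 2 * m" by (auto intro!: lt)
    then show "a (\<tau> (2 * k)) (\<tau> (2 * k + 1))
        = (if k \<in> S then -1 else 1) * a (\<sigma> (2 * \<pi> k)) (\<sigma> (2 * \<pi> k + 1))"
      using skew[of "\<sigma> (2 * \<pi> k)" "\<sigma> (2 * \<pi> k + 1)"] by (simp add: \<tau>_def)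
  qed
  also have "\<dots> = (\<Prod>k<m. if k \<in> S then -1 else 1) * (\<Prod>k<m. a (\<sigma> (2 * \<pi> k)) (\<sigma> (2 * \<pi> k + 1)))"
    by (rule prod.distrib)
  also have "(\<Prod>k<m. if k \<in> S then -1 else 1 :: 'a) = (-1) ^ card S"
  proof -
    have "{..<m} \<inter> {k. k \<in> S} = S" using S by auto
    then show ?thesis by (simp add: prod.If_cases)
  qed
  also have "(\<Prod>k<m. a (\<sigma> (2 * \<pi> k)) (\<sigma> (2 * \<pi> k + 1))) = (\<Prod>k<m. a (\<sigma> (2 * k)) (\<sigma> (2 * k + 1)))"
    using prod.permute[OF \<pi>, of "\<lambda>k. a (\<sigma> (2 * k)) (\<sigma> (2 * k + 1))"] by (simp add: o_def)
  finally have pr: "(\<Prod>k<m. a (\<tau> (2 * k)) (\<tau> (2 * k + 1)))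
      = (-1) ^ card S * (\<Prod>k<m. a (\<sigma> (2 * k)) (\<sigma> (2 * k + 1)))" .
  have "sign \<tau> = sign \<sigma> * (-1) ^ card S"
    unfolding \<tau>_def using sign_pair_perm[OF \<pi> S] pair_perm_permutes[OF \<pi> S] \<sigma>
    by (subst sign_compose) (auto intro: permutes_imp_permutation[OF finite_lessThan])
  then have "of_int (sign \<tau>) = of_int (sign \<sigma>) * ((-1) ^ card S :: 'a)" by simp
  moreover have "((-1) ^ card S :: 'a) * (-1) ^ card S = 1"
    by (simp flip: power_add)
  ultimately show ?thesis unfolding pr
    by (metis (no_types, lifting) mult.assoc mult.right_neutral)
qed

text \<open>Permutations correspond bijectively to a matching together with an element of the group
  acting on its listings. Terms are constant along that group, so its order m! 2^m comes out as a
  factor.\<close>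

lemma pf_perm_sum_eq_pfaffian:
  fixes A :: "'a::comm_ring_1 mat"
  assumes dim: "dim_row A = 2 * m"
    and skew: "\<And>i j. i < 2 * m \<Longrightarrow> j < 2 * m \<Longrightarrow> A $$ (j, i) = - A $$ (i, j)"
  shows "pf_perm_sum m (\<lambda>i j. A $$ (i, j)) = of_nat (2 ^ m * fact m) * pfaffian A"
proof -
  define T where "T \<sigma> = of_int (sign \<sigma>) * (\<Prod>k<m. A $$ (\<sigma> (2 * k), \<sigma> (2 * k + 1)))" for \<sigma>
  define E where "E = matching_enum (2 * m)"
  let ?X = "{\<pi>. \<pi> permutes {..<m}} \<times> Pow {..<m}"
  let ?f = "\<lambda>(P, (\<pi>, S)). E P \<circ> pair_perm \<pi> S"
  have EP: "E P permutes {..<2 * m}" "matching_of m (E P) = P" if "P \<in> perfect_matchings (2 * m)" for P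
    using matching_enum_permutes[OF that] by (simp_all add: E_def)
  have bij: "bij_betw ?f (perfect_matchings (2 * m) \<times> ?X) {\<sigma>. \<sigma> permutes {..<2 * m}}"
  proof (rule bij_betw_imageI)
    show "inj_on ?f (perfect_matchings (2 * m) \<times> ?X)"
    proof (rule inj_onI, clarsimp)
      fix P \<pi> S P' \<pi>' S'
      assume P: "P \<in> perfect_matchings (2 * m)" "P' \<in> perfect_matchings (2 * m)"
        and h: "\<pi> permutes {..<m}" "S \<subseteq> {..<m}" "\<pi>' permutes {..<m}" "S' \<subseteq> {..<m}"
        and eq: "E P \<circ> pair_perm \<pi> S = E P' \<circ> pair_perm \<pi>' S'"
      have "P = P'"
        using arg_cong[OF eq, of "matching_of m"] EP(2) P
        by (simp add: matching_of_comp_pair_perm h(1,3))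
      moreover from this have "pair_perm \<pi> S = pair_perm \<pi>' S'"
        using eq fun.inj_map_strong permutes_inj[OF EP(1)[OF P(1)]]
        by (metis (no_types, lifting) fun.map_comp inv_o_cancel fun.map_id)
      ultimately show "P = P' \<and> \<pi> = \<pi>' \<and> S = S'" using pair_perm_inj[OF h] by simp
    qed
    show "?f ` (perfect_matchings (2 * m) \<times> ?X) = {\<sigma>. \<sigma> permutes {..<2 * m}}"
    proof (intro equalityI subsetI)
      fix \<sigma> assume "\<sigma> \<in> {\<sigma>. \<sigma> permutes {..<2 * m}}"
      then have \<sigma>: "\<sigma> permutes {..<2 * m}" by simp
      let ?P = "matching_of m \<sigma>"
      have P: "?P \<in> perfect_matchings (2 * m)" by (rule matching_of_perfect[OF \<sigma>])
      obtain \<pi> S where "\<pi> permutes {..<m}" "S \<subseteq> {..<m}" "\<sigma> = E ?P \<circ> pair_perm \<pi> S"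
        using same_matching_imp_pair_perm[OF \<sigma> EP(1)[OF P]] EP(2)[OF P] by auto
      then show "\<sigma> \<in> ?f ` (perfect_matchings (2 * m) \<times> ?X)"
        using P by (intro image_eqI[of _ _ "(?P, (\<pi>, S))"]) auto
    qed (auto intro!: permutes_compose pair_perm_permutes EP)
  qed
  have "pf_perm_sum m (\<lambda>i j. A $$ (i, j)) = (\<Sum>\<sigma> | \<sigma> permutes {..<2 * m}. T \<sigma>)"
    by (simp add: pf_perm_sum_def T_def)
  also have "\<dots> = (\<Sum>x\<in>perfect_matchings (2 * m) \<times> ?X. T (?f x))"
    by (rule sum.reindex_bij_betw[OF bij, symmetric])
  also have "\<dots> = (\<Sum>P\<in>perfect_matchings (2 * m). \<Sum>x\<in>?X. T (E P \<circ> pair_perm (fst x) (snd x)))"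
    by (simp add: sum.cartesian_product case_prod_unfold)
  also have "\<dots> = (\<Sum>P\<in>perfect_matchings (2 * m). \<Sum>x\<in>?X. T (E P))"
  proof (intro sum.cong refl)
    fix P x assume "P \<in> perfect_matchings (2 * m)" "x \<in> ?X"
    then show "T (E P \<circ> pair_perm (fst x) (snd x)) = T (E P)"
      unfolding T_def by (intro prod_pair_perm[where a = "\<lambda>i j. A $$ (i, j)"] EP skew) auto
  qed
  also have "\<dots> = (\<Sum>P\<in>perfect_matchings (2 * m). of_nat (2 ^ m * fact m) * T (E P))"
    by (simp add: card_cartesian_product card_permutations card_Pow mult.commute)
  also have "\<dots> = of_nat (2 ^ m * fact m) * (\<Sum>P\<in>perfect_matchings (2 * m). T (E P))"
    by (simp only: sum_distrib_left)
  also have "(\<Sum>P\<in>perfect_matchings (2 * m). T (E P)) = pfaffian A"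
    unfolding pfaffian_def dim
  proof (rule sum.cong[OF refl])
    fix P assume P: "P \<in> perfect_matchings (2 * m)"
    let ?e = "\<lambda>k. {E P (2 * k), E P (2 * k + 1)}"
    have en: "\<forall>k<m. E P (2 * k) < E P (2 * k + 1)" "P = ?e ` {..<m}"
      using matching_enum[OF P] unfolding E_def[symmetric] enumerates_matching_def by auto
    have "(\<Prod>e\<in>P. A $$ (Min e, Max e)) = (\<Prod>e\<in>?e ` {..<m}. A $$ (Min e, Max e))"
      using en(2) by simp
    also have "\<dots> = (\<Prod>k<m. A $$ (Min (?e k), Max (?e k)))"
      by (subst prod.reindex) (use inj_on_subset[OF inj_matching_of[OF EP(1)[OF P]]] in auto)
    \<comment> \<open>The chosen enumeration lists the smaller element first, so \<open>Min\<close>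
      and \<open>Max\<close> are its even and odd values.\<close>
    also have "\<dots> = (\<Prod>k<m. A $$ (E P (2 * k), E P (2 * k + 1)))"
      using en(1) by (intro prod.cong) (auto simp: min_def max_def)
    finally show "T (E P) = of_int (matching_sign (2 * m) P) * (\<Prod>e\<in>P. A $$ (Min e, Max e))"
      by (simp add: T_def matching_sign_def E_def matching_enum_def)
  qed
  finally show ?thesis .
qed

section \<open>Distinguishing a pair\<close>

lemma insert_delete_index_neq:
  "x \<noteq> y \<Longrightarrow> insert_index y (delete_index y x) = x"
  by (auto simp: insert_index_def delete_index_def)

text \<open>The increasing enumeration of the complement of \<open>{x, y}\<close>.\<close>
definition skip_two :: "nat \<Rightarrow> nat \<Rightarrow> nat \<Rightarrow> nat" where
  "skip_two x y k = insert_index y (insert_index (delete_index y x) k)"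

lemma skip_two_neq:
  assumes "x \<noteq> y"
  shows "skip_two x y k \<noteq> x" "skip_two x y k \<noteq> y"
  using assms by (auto simp: skip_two_def insert_index_def delete_index_def)

lemma skip_two_less: "k < l \<Longrightarrow> skip_two x y k < Suc (Suc l)"
  by (auto simp: skip_two_def insert_index_def)

lemma strict_mono_skip_two: "strict_mono (skip_two x y)"
  by (rule strict_monoI) (auto simp: skip_two_def insert_index_def)

lemma range_skip_two:
  assumes "x \<noteq> y"
  shows "range (skip_two x y) = - {x, y}"
proof (intro equalityI subsetI)
  fix a assume "a \<in> - {x, y}"
  then have a: "a \<noteq> x" "a \<noteq> y" by auto
  then have "delete_index y a \<noteq> delete_index y x"
    using assms by (metis insert_delete_index_neq)
  then have "a = skip_two x y (delete_index (delete_index y x) (delete_index y a))"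
    using a(2) by (simp add: skip_two_def insert_delete_index_neq)
  then show "a \<in> range (skip_two x y)" by blast
qed (use skip_two_neq[OF assms] in auto)

text \<open>Links \<open>skip_two\<close> with the indexing of \<open>submatrix\<close>: being
  strictly increasing with range the complement, \<open>skip_two\<close> has exactly k elements of
  the complement below its k-th value.\<close>

lemma pick_compl_two:
  assumes "x \<noteq> y"
  shows "pick (- {x, y}) k = skip_two x y k"
proof -
  have "{a \<in> - {x, y}. a < skip_two x y k} = skip_two x y ` {..<k}"
    unfolding range_skip_two[OF assms, symmetric]
    using strict_mono_less[OF strict_mono_skip_two] by auto
  then have "card {a \<in> - {x, y}. a < skip_two x y k} = k"
    by (simp add: card_image strict_mono_imp_inj_on[OF strict_mono_skip_two])
  moreover have "skip_two x y k \<in> - {x, y}" using range_skip_two[OF assms] by blast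
  ultimately show ?thesis using pick_card_in_set[of "skip_two x y k" "- {x, y}"] by simp
qed

lemma card_compl_two:
  assumes "x \<noteq> y" "x < Suc (Suc l)" "y < Suc (Suc l)"
  shows "card {i. i < Suc (Suc l) \<and> i \<in> - {x, y}} = l"
proof -
  have "{i. i < Suc (Suc l) \<and> i \<in> - {x, y}} = {..<Suc (Suc l)} - {x, y}" by auto
  then show ?thesis using assms by simp
qed

lemma remove_two_dim:
  assumes "A \<in> carrier_mat (Suc (Suc l)) (Suc (Suc l))" "x \<noteq> y" "x < Suc (Suc l)" "y < Suc (Suc l)"
  shows "remove_two A x y \<in> carrier_mat l l"
  by (rule carrier_matI)
    (simp_all only: remove_two_def dim_submatrix carrier_matD[OF assms(1)] card_compl_two[OF assms(2-4)])

lemma remove_two_index: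
  assumes "A \<in> carrier_mat (Suc (Suc l)) (Suc (Suc l))" "x \<noteq> y" "x < Suc (Suc l)" "y < Suc (Suc l)"
    and "a < l" "b < l"
  shows "remove_two A x y $$ (a, b) = A $$ (skip_two x y a, skip_two x y b)"
proof -
  have c: "card {i. i < dim_row A \<and> i \<in> - {x, y}} = l" "card {i. i < dim_col A \<and> i \<in> - {x, y}} = l"
    by (simp_all only: carrier_matD[OF assms(1)] card_compl_two[OF assms(2-4)])
  show ?thesis
    unfolding remove_two_def
    by (subst submatrix_index) (simp_all only: c assms(5,6) pick_compl_two[OF assms(2)])
qed

lemma remove_two_commute: "remove_two A x y = remove_two A y x"
  by (simp add: remove_two_def insert_commute)

text \<open>The permutation that sends \<open>l\<close> to \<open>x\<close>, \<open>l + 1\<close> to \<open>y\<close> and acts below \<open>l\<close> as \<open>q\<close> does, after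
  renumbering the complement of \<open>{x, y}\<close>.\<close>
definition extend_two :: "nat \<Rightarrow> nat \<Rightarrow> nat \<Rightarrow> (nat \<Rightarrow> nat) \<Rightarrow> nat \<Rightarrow> nat" where
  "extend_two l x y q = permutation_insert (Suc l) y (permutation_insert l (delete_index y x) q)"

lemma delete_index_less:
  assumes "x \<noteq> y" "x < Suc (Suc l)" "y < Suc (Suc l)"
  shows "delete_index y x < Suc l"
  using assms by (auto simp: delete_index_def)

lemma extend_two_apply:
  assumes "x \<noteq> y"
  shows "extend_two l x y q (Suc l) = y" "extend_two l x y q l = x"
    "k < l \<Longrightarrow> extend_two l x y q k = skip_two x y (q k)"
  using insert_delete_index_neq[OF assms]
  by (auto simp: extend_two_def skip_two_def permutation_insert_def insert_dom_def insert_ran_def)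

text \<open>Each of the two insertions contributes -1 to the power position plus value. The value x
  is inserted after y has been removed, so it drops by one exactly if y < x; this is the source of
  the two cases in the sign of Padj.\<close>

lemma sign_extend_two:
  assumes "x \<noteq> y" "x < Suc (Suc l)" "y < Suc (Suc l)" "even l" "q permutes {..<l}"
  shows "(of_int (sign (extend_two l x y q)) :: 'a::ring_1)
     = (if x < y then (-1) ^ (x + y + 1) else (-1) ^ (x + y)) * of_int (sign q)"
proof -
  let ?x = "delete_index y x"
  have x: "?x < Suc l" using delete_index_less[OF assms(1-3)] .
  have q: "q permutes {0..<l}" using assms(5) by (simp add: atLeast0LessThan)
  have "(of_int (sign (extend_two l x y q)) :: 'a)
      = (-1) ^ (Suc l + y) * ((-1) ^ (l + ?x) * of_int (sign q))"
    unfolding extend_two_def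
    by (simp only: signof_permutation_insert[OF permutation_insert_permutes[OF q lessI x] lessI assms(3)]
        signof_permutation_insert[OF q lessI x])
  also have "\<dots> = (-1) ^ (Suc l + y + (l + ?x)) * of_int (sign q)"
    by (simp add: power_add mult.assoc)
  also have "(-1) ^ (Suc l + y + (l + ?x)) = (if x < y then (-1) ^ (x + y + 1) else (-1 :: 'a) ^ (x + y))"
    using assms(1,4) by (auto simp: delete_index_def minus_one_power_iff)
  finally show ?thesis .
qed

text \<open>Two rounds of the bijection behind Laplace expansion, which prescribes one value of a
  permutation. In the second round the prescribed value x is renumbered because y is already
  gone.\<close>

lemma permutes_fix_two:
  assumes "x \<noteq> y" "x < Suc (Suc l)" "y < Suc (Suc l)"
  shows "bij_betw (extend_two l x y) {q. q permutes {..<l}}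
    {\<sigma>. \<sigma> permutes {..<Suc (Suc l)} \<and> \<sigma> l = x \<and> \<sigma> (Suc l) = y}"
proof -
  let ?x = "delete_index y x"
  have x: "?x < Suc l" using delete_index_less[OF assms] .
  have 1: "bij_betw (permutation_insert l ?x) {q. q permutes {0..<l}}
      {p. p permutes {0..<Suc l} \<and> p l = ?x}"
    unfolding permutation_fix[OF lessI x]
    by (rule inj_on_imp_bij_betw[OF permutation_insert_inj_on[OF lessI x]])
  have 2: "bij_betw (permutation_insert (Suc l) y) {p. p permutes {0..<Suc l}}
      {\<sigma>. \<sigma> permutes {0..<Suc (Suc l)} \<and> \<sigma> (Suc l) = y}"
    unfolding permutation_fix[OF lessI assms(3)]
    by (rule inj_on_imp_bij_betw[OF permutation_insert_inj_on[OF lessI assms(3)]])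
  have ap: "permutation_insert (Suc l) y p l = x \<longleftrightarrow> p l = ?x" for p
    using insert_delete_index_neq[OF assms(1)]
    by (auto simp: permutation_insert_def insert_dom_def insert_ran_def)
  have "bij_betw (permutation_insert (Suc l) y) {p. p permutes {0..<Suc l} \<and> p l = ?x}
      {\<sigma>. \<sigma> permutes {0..<Suc (Suc l)} \<and> \<sigma> l = x \<and> \<sigma> (Suc l) = y}"
    using bij_betw_Collect[OF 2, of "\<lambda>\<sigma>. \<sigma> l = x" "\<lambda>p. p l = ?x"] ap by (simp add: conj_ac)
  from bij_betw_trans[OF 1 this] show ?thesis
    by (simp add: atLeast0LessThan extend_two_def[abs_def] o_def)
qed

text \<open>The permutations are grouped by their last two values.\<close>

lemma sum_permutes_extend_two:
  fixes F :: "(nat \<Rightarrow> nat) \<Rightarrow> 'a::comm_monoid_add"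
  shows "(\<Sum>\<sigma> | \<sigma> permutes {..<Suc (Suc l)}. F \<sigma>)
    = (\<Sum>(x, y) | x < Suc (Suc l) \<and> y < Suc (Suc l) \<and> x \<noteq> y.
        \<Sum>q | q permutes {..<l}. F (extend_two l x y q))"
proof -
  let ?S = "{\<sigma>. \<sigma> permutes {..<Suc (Suc l)}}"
  let ?T = "{(x, y). x < Suc (Suc l) \<and> y < Suc (Suc l) \<and> x \<noteq> y}"
  let ?g = "\<lambda>\<sigma>. (\<sigma> l, \<sigma> (Suc l))"
  have fin: "finite ?S" by (simp add: finite_permutations)
  have "?T \<subseteq> {..<Suc (Suc l)} \<times> {..<Suc (Suc l)}" by auto
  then have finT: "finite ?T" by (rule finite_subset) simp
  have sub: "?g ` ?S \<subseteq> ?T"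
  proof (clarsimp, intro conjI)
    fix \<sigma> assume p: "\<sigma> permutes {..<Suc (Suc l)}"
    show "\<sigma> l < Suc (Suc l)" "\<sigma> (Suc l) < Suc (Suc l)"
      using permutes_in_image[OF p, of l] permutes_in_image[OF p, of "Suc l"] by auto
    show "\<sigma> l \<noteq> \<sigma> (Suc l)" using permutes_inj[OF p] by (auto simp: inj_eq)
  qed
  have "(\<Sum>\<sigma>\<in>?S. F \<sigma>) = (\<Sum>z\<in>?T. \<Sum>\<sigma>\<in>{\<sigma> \<in> ?S. ?g \<sigma> = z}. F \<sigma>)"
    by (rule sum.group[OF fin finT sub, symmetric])
  also have "\<dots> = (\<Sum>(x, y)\<in>?T. \<Sum>q | q permutes {..<l}. F (extend_two l x y q))"
  proof (rule sum.cong[OF refl], clarify)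
    fix x y assume "x < Suc (Suc l)" "y < Suc (Suc l)" "x \<noteq> y"
    then show "(\<Sum>\<sigma>\<in>{\<sigma> \<in> ?S. ?g \<sigma> = (x, y)}. F \<sigma>) = (\<Sum>q | q permutes {..<l}. F (extend_two l x y q))"
      using sum.reindex_bij_betw[OF permutes_fix_two[of x y l], of F] by simp
  qed
  finally show ?thesis .
qed

text \<open>Stated for the transposed entry since its sign is then the one produced by
  \<open>sign_extend_two\<close>, and since products such as A Padj(A) pair (x, y) with (y,
  x).\<close>

lemma pfaff_adjugate_index:
  assumes "A \<in> carrier_mat n n" "x < n" "y < n"
  shows "pfaff_adjugate A $$ (y, x) = (if x = y then 0
    else (if x < y then (-1) ^ (x + y + 1) else (-1) ^ (x + y)) * pfaffian (remove_two A x y))"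
  using assms by (auto simp: pfaff_adjugate_def remove_two_commute[of A y x] add.commute)

lemma pfaff_adjugate_skew:
  assumes "A \<in> carrier_mat n n" "x < n" "y < n"
  shows "pfaff_adjugate A $$ (y, x) = - pfaff_adjugate A $$ (x, y)"
  using pfaff_adjugate_index[OF assms] pfaff_adjugate_index[OF assms(1,3,2)]
  by (auto simp: remove_two_commute[of A y x] add.commute)

text \<open>Exchanging two pairs is an even permutation.\<close>
lemma sum_permutes_move_pair:
  fixes a g :: "nat \<Rightarrow> nat \<Rightarrow> 'a::comm_ring_1"
  assumes "k < Suc l"
  shows "(\<Sum>\<sigma> | \<sigma> permutes {..<2 * Suc l}. of_int (sign \<sigma>) * (g (\<sigma> (2 * k)) (\<sigma> (2 * k + 1))
            * (\<Prod>j\<in>{..<Suc l} - {k}. a (\<sigma> (2 * j)) (\<sigma> (2 * j + 1)))))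
       = (\<Sum>\<sigma> | \<sigma> permutes {..<2 * Suc l}. of_int (sign \<sigma>) * (g (\<sigma> (2 * l)) (\<sigma> (2 * l + 1))
            * (\<Prod>j<l. a (\<sigma> (2 * j)) (\<sigma> (2 * j + 1)))))"
proof -
  define \<pi> where "\<pi> = transpose k l"
  have \<pi>: "\<pi> permutes {..<Suc l}" unfolding \<pi>_def using assms by (intro permutes_swap_id) auto
  let ?q = "pair_perm \<pi> {}"
  have q: "?q permutes {..<2 * Suc l}" by (rule pair_perm_permutes[OF \<pi>]) simp
  have sgn: "sign (\<sigma> \<circ> ?q) = sign \<sigma>" if "\<sigma> permutes {..<2 * Suc l}" for \<sigma>
    using that q sign_pair_perm_empty[OF \<pi>] permutes_imp_permutation[OF finite_lessThan]
    by (simp add: sign_compose del: o_apply)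
  \<comment> \<open>As \<pi> exchanges k and l, the positions other than k are carried onto those
    below l.\<close>
  have bij: "bij_betw \<pi> ({..<Suc l} - {k}) {..<l}"
  proof (rule bij_betw_imageI)
    show "inj_on \<pi> ({..<Suc l} - {k})" by (simp add: \<pi>_def)
    show "\<pi> ` ({..<Suc l} - {k}) = {..<l}"
    proof (intro equalityI subsetI)
      fix x assume "x \<in> {..<l}"
      then show "x \<in> \<pi> ` ({..<Suc l} - {k})"
        using assms by (intro image_eqI[of _ _ "\<pi> x"]) (auto simp: \<pi>_def transpose_def)
    qed (use assms in \<open>auto simp: \<pi>_def transpose_def\<close>)
  qed
  have pr: "(\<Prod>j\<in>{..<Suc l} - {k}. h (\<pi> j)) = (\<Prod>j<l. h j)" for h :: "nat \<Rightarrow> 'a"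
    by (rule prod.reindex_bij_betw[OF bij])
  have "\<pi> k = l" by (simp add: \<pi>_def)
  let ?F = "\<lambda>\<sigma>. of_int (sign \<sigma>) * (g (\<sigma> (2 * k)) (\<sigma> (2 * k + 1))
            * (\<Prod>j\<in>{..<Suc l} - {k}. a (\<sigma> (2 * j)) (\<sigma> (2 * j + 1))))"
  have "sum ?F {\<sigma>. \<sigma> permutes {..<2 * Suc l}} = (\<Sum>\<sigma> | \<sigma> permutes {..<2 * Suc l}. ?F (\<sigma> \<circ> ?q))"
    by (rule sum_permutations_compose_right[OF q])
  also have "\<dots> = (\<Sum>\<sigma> | \<sigma> permutes {..<2 * Suc l}. of_int (sign \<sigma>) * (g (\<sigma> (2 * l)) (\<sigma> (2 * l + 1))
            * (\<Prod>j<l. a (\<sigma> (2 * j)) (\<sigma> (2 * j + 1)))))"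
  proof (rule sum.cong[OF refl])
    fix \<sigma> assume "\<sigma> \<in> {\<sigma>. \<sigma> permutes {..<2 * Suc l}}"
    then have "sign (\<sigma> \<circ> ?q) = sign \<sigma>" using sgn by simp
    then show "?F (\<sigma> \<circ> ?q) = of_int (sign \<sigma>) * (g (\<sigma> (2 * l)) (\<sigma> (2 * l + 1))
            * (\<Prod>j<l. a (\<sigma> (2 * j)) (\<sigma> (2 * j + 1))))"
      using pr[of "\<lambda>j. a (\<sigma> (2 * j)) (\<sigma> (2 * j + 1))"] by (simp add: \<open>\<pi> k = l\<close>)
  qed
  finally show ?thesis .
qed

lemma sum_mult_sum_swap:
  "(\<Sum>x\<in>X. c x * (\<Sum>k\<in>K. f x k)) = (\<Sum>k\<in>K. \<Sum>x\<in>X. c x * f x k :: 'a::semiring_0)"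
  by (subst sum.swap) (simp add: sum_distrib_left)

text \<open>Replacing one factor of every term by \<open>g\<close> is a directional derivative of
  the permutation sum. All positions of the replaced factor contribute equally, and with the last
  one fixed to (x, y) the remaining factors form the permutation sum of the minor. The free choice
  of \<open>g\<close> serves two purposes: the entries in row or column i give the row expansion,
  and J gives the derivative in t.\<close>

lemma sum_permutes_distinguished_pair:
  fixes A :: "'a::comm_ring_1 mat" and g :: "nat \<Rightarrow> nat \<Rightarrow> 'a"
  assumes A: "A \<in> carrier_mat (2 * Suc l) (2 * Suc l)"
    and skew: "\<And>i j. i < 2 * Suc l \<Longrightarrow> j < 2 * Suc l \<Longrightarrow> A $$ (j, i) = - A $$ (i, j)"
  shows "(\<Sum>\<sigma> | \<sigma> permutes {..<2 * Suc l}. of_int (sign \<sigma>) *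
           (\<Sum>k<Suc l. g (\<sigma> (2 * k)) (\<sigma> (2 * k + 1))
              * (\<Prod>j\<in>{..<Suc l} - {k}. A $$ (\<sigma> (2 * j), \<sigma> (2 * j + 1)))))
       = of_nat (2 ^ l * fact (Suc l)) *
           (\<Sum>x<2 * Suc l. \<Sum>y<2 * Suc l. g x y * pfaff_adjugate A $$ (y, x))"
proof -
  let ?n = "Suc (Suc (2 * l))"
  let ?T = "{(x, y). x < ?n \<and> y < ?n \<and> x \<noteq> y}"
  let ?s = "\<lambda>x y. if x < y then (-1) ^ (x + y + 1) else (-1 :: 'a) ^ (x + y)"
  define last where "last = (\<Sum>\<sigma> | \<sigma> permutes {..<2 * Suc l}. of_int (sign \<sigma>) *
      (g (\<sigma> (2 * l)) (\<sigma> (2 * l + 1)) * (\<Prod>j<l. A $$ (\<sigma> (2 * j), \<sigma> (2 * j + 1)))))"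
  have A': "A \<in> carrier_mat ?n ?n" using A by simp
  have inner: "(\<Sum>q | q permutes {..<2 * l}. of_int (sign (extend_two (2 * l) x y q)) *
        (g (extend_two (2 * l) x y q (2 * l)) (extend_two (2 * l) x y q (2 * l + 1)) *
          (\<Prod>j<l. A $$ (extend_two (2 * l) x y q (2 * j), extend_two (2 * l) x y q (2 * j + 1)))))
      = of_nat (2 ^ l * fact l) * (g x y * pfaff_adjugate A $$ (y, x))" (is "?L = _")
    if xy: "x < ?n" "y < ?n" "x \<noteq> y" for x y
  proof -
    let ?R = "remove_two A x y"
    have R: "?R \<in> carrier_mat (2 * l) (2 * l)" using remove_two_dim[OF A'] xy by simp
    have Ri: "?R $$ (a, b) = A $$ (skip_two x y a, skip_two x y b)" if "a < 2 * l" "b < 2 * l" for a b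
      using remove_two_index[OF A'] xy that by simp
    have "?L = (\<Sum>q | q permutes {..<2 * l}. ?s x y * g x y *
        (of_int (sign q) * (\<Prod>j<l. ?R $$ (q (2 * j), q (2 * j + 1)))))"
    proof (rule sum.cong[OF refl])
      fix q assume "q \<in> {q. q permutes {..<2 * l}}"
      then have q: "q permutes {..<2 * l}" by simp
      have lt: "q k < 2 * l" if "k < 2 * l" for k using permutes_in_image[OF q, of k] that by simp
      have "(\<Prod>j<l. A $$ (extend_two (2 * l) x y q (2 * j), extend_two (2 * l) x y q (2 * j + 1)))
          = (\<Prod>j<l. ?R $$ (q (2 * j), q (2 * j + 1)))"
      proof (rule prod.cong[OF refl])
        fix j assume "j \<in> {..<l}"
        then have j: "2 * j < 2 * l" "2 * j + 1 < 2 * l" by auto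
        show "A $$ (extend_two (2 * l) x y q (2 * j), extend_two (2 * l) x y q (2 * j + 1))
            = ?R $$ (q (2 * j), q (2 * j + 1))"
          using extend_two_apply(3)[OF xy(3) j(1), of q] extend_two_apply(3)[OF xy(3) j(2), of q]
            Ri[OF lt[OF j(1)] lt[OF j(2)]] by simp
      qed
      moreover have "extend_two (2 * l) x y q (2 * l) = x" "extend_two (2 * l) x y q (2 * l + 1) = y"
        using extend_two_apply(1,2)[OF xy(3), of "2 * l" q] by simp_all
      moreover have "(of_int (sign (extend_two (2 * l) x y q)) :: 'a) = ?s x y * of_int (sign q)"
        using sign_extend_two[OF xy(3,1,2) _ q] by simp
      ultimately show "of_int (sign (extend_two (2 * l) x y q)) *
        (g (extend_two (2 * l) x y q (2 * l)) (extend_two (2 * l) x y q (2 * l + 1)) *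
          (\<Prod>j<l. A $$ (extend_two (2 * l) x y q (2 * j), extend_two (2 * l) x y q (2 * j + 1))))
        = ?s x y * g x y * (of_int (sign q) * (\<Prod>j<l. ?R $$ (q (2 * j), q (2 * j + 1))))"
        by (simp only: mult_ac)
    qed
    also have "\<dots> = ?s x y * g x y * pf_perm_sum l (\<lambda>i j. ?R $$ (i, j))"
      by (simp only: pf_perm_sum_def sum_distrib_left)
    also have "pf_perm_sum l (\<lambda>i j. ?R $$ (i, j)) = of_nat (2 ^ l * fact l) * pfaffian ?R"
    proof (rule pf_perm_sum_eq_pfaffian)
      show "dim_row ?R = 2 * l" using R by simp
      fix a b assume ab: "a < 2 * l" "b < 2 * l"
      then show "?R $$ (b, a) = - ?R $$ (a, b)"
        using Ri[OF ab] Ri[OF ab(2,1)] skew[of "skip_two x y a" "skip_two x y b"]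
          skip_two_less[of a "2 * l" x y] skip_two_less[of b "2 * l" x y] by simp
    qed
    also have "?s x y * g x y * (of_nat (2 ^ l * fact l) * pfaffian ?R)
        = of_nat (2 ^ l * fact l) * (g x y * pfaff_adjugate A $$ (y, x))"
      using pfaff_adjugate_index[OF A' xy(1,2)] xy(3) by (simp only: mult_ac if_False)
    finally show ?thesis .
  qed
  have "last = (\<Sum>(x, y)\<in>?T. \<Sum>q | q permutes {..<2 * l}. of_int (sign (extend_two (2 * l) x y q)) *
        (g (extend_two (2 * l) x y q (2 * l)) (extend_two (2 * l) x y q (2 * l + 1)) *
          (\<Prod>j<l. A $$ (extend_two (2 * l) x y q (2 * j), extend_two (2 * l) x y q (2 * j + 1)))))"
    unfolding last_def mult_Suc_right add_2_eq_Suc by (rule sum_permutes_extend_two)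
  also have "\<dots> = (\<Sum>(x, y)\<in>?T. of_nat (2 ^ l * fact l) * (g x y * pfaff_adjugate A $$ (y, x)))"
    using inner by (intro sum.cong[OF refl]) auto
  \<comment> \<open>The diagonal pairs may be added because Padj vanishes there.\<close>
  also have "\<dots> = (\<Sum>(x, y)\<in>{..<?n} \<times> {..<?n}. of_nat (2 ^ l * fact l) * (g x y * pfaff_adjugate A $$ (y, x)))"
    using pfaff_adjugate_index[OF A'] by (intro sum.mono_neutral_left) auto
  also have "\<dots> = of_nat (2 ^ l * fact l) * (\<Sum>x<?n. \<Sum>y<?n. g x y * pfaff_adjugate A $$ (y, x))"
    by (simp only: sum.cartesian_product sum_distrib_left case_prod_unfold)
  finally have last: "last = of_nat (2 ^ l * fact l) * (\<Sum>x<?n. \<Sum>y<?n. g x y * pfaff_adjugate A $$ (y, x))" .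
  have "(\<Sum>\<sigma> | \<sigma> permutes {..<2 * Suc l}. of_int (sign \<sigma>) *
           (\<Sum>k<Suc l. g (\<sigma> (2 * k)) (\<sigma> (2 * k + 1))
              * (\<Prod>j\<in>{..<Suc l} - {k}. A $$ (\<sigma> (2 * j), \<sigma> (2 * j + 1)))))
      = (\<Sum>k<Suc l. \<Sum>\<sigma> | \<sigma> permutes {..<2 * Suc l}. of_int (sign \<sigma>) *
           (g (\<sigma> (2 * k)) (\<sigma> (2 * k + 1))
              * (\<Prod>j\<in>{..<Suc l} - {k}. A $$ (\<sigma> (2 * j), \<sigma> (2 * j + 1)))))"
    by (rule sum_mult_sum_swap)
  also have "\<dots> = (\<Sum>k<Suc l. last)"
    unfolding last_def
    by (intro sum.cong[OF refl] sum_permutes_move_pair[where a = "\<lambda>i j. A $$ (i, j)"]) simp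
  \<comment> \<open>The number of positions turns l! into (l + 1)!.\<close>
  also have "\<dots> = of_nat (Suc l) * last" by simp
  also have "\<dots> = of_nat (2 ^ l * fact (Suc l)) * (\<Sum>x<?n. \<Sum>y<?n. g x y * pfaff_adjugate A $$ (y, x))"
    unfolding last by (simp add: algebra_simps del: sum.lessThan_Suc)
  finally show ?thesis by (simp only: mult_Suc_right add_2_eq_Suc)
qed

section \<open>Expansion and derivative of the Pfaffian\<close>

text \<open>Exactly what is needed to cancel 2^m m!. Shared by R and R[t], so the identity for Padj
  is proved once and used over both rings.\<close>

class torsion_free_ring = comm_ring_1 +
  assumes of_nat_mult_eq_0: "0 < n \<Longrightarrow> of_nat n * x = 0 \<Longrightarrow> x = 0"
begin

lemma of_nat_mult_left_cancel:
  assumes "0 < n" "of_nat n * x = of_nat n * y"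
  shows "x = y"
  using of_nat_mult_eq_0[OF assms(1), of "x - y"] assms(2) by (simp add: algebra_simps)

end

lemma coeff_of_nat_mult: "coeff (of_nat n * p) i = of_nat n * coeff p i"
  by (simp add: of_nat_poly)

lemma coeff_of_int_mult: "coeff (of_int n * p) i = of_int n * coeff p i"
  by (simp add: of_int_poly)

instance poly :: (torsion_free_ring) torsion_free_ring
proof
  fix n :: nat and p :: "'a poly"
  assume "0 < n" "of_nat n * p = 0"
  then have "of_nat n * coeff p i = 0" for i by (metis coeff_of_nat_mult coeff_0)
  then show "p = 0" by (metis of_nat_mult_eq_0 \<open>0 < n\<close> poly_eqI coeff_0)
qed

context comm_rat_algebra
begin

lemma scaleQ_zero_right: "q *\<^sub>Q 0 = 0"
  using scaleQ_add_right[of q 0 0] by simp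

lemma scaleQ_of_nat: "of_nat n *\<^sub>Q x = of_nat n * x"
proof (induction n)
  case 0
  show ?case using scaleQ_add_left[of 0 0 x] by simp
next
  case (Suc n)
  then show ?case
    using scaleQ_add_left[of 1 "of_nat n" x] scaleQ_one[of x] by (simp add: local.distrib_right)
qed

lemma scaleQ_inverse_of_nat:
  assumes "0 < n"
  shows "(1 / of_nat n) *\<^sub>Q (of_nat n * x) = x"
  using assms scaleQ_scaleQ[of "1 / of_nat n" "of_nat n" x] by (simp add: scaleQ_of_nat scaleQ_one)

subclass torsion_free_ring
  by standard (metis scaleQ_inverse_of_nat scaleQ_zero_right)

end

lemma skew_symmetricD:
  assumes "skew_symmetric A" "A \<in> carrier_mat n n" "i < n" "j < n"
  shows "A $$ (j, i) = - A $$ (i, j)"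
proof -
  have "transpose_mat A $$ (i, j) = (- A) $$ (i, j)" using assms(1) by (simp add: skew_symmetric_def)
  then show ?thesis using assms(2-4) by simp
qed

lemma skew_symmetricI:
  assumes "A \<in> carrier_mat n n" "\<And>i j. i < n \<Longrightarrow> j < n \<Longrightarrow> A $$ (j, i) = - A $$ (i, j)"
  shows "skew_symmetric A"
  unfolding skew_symmetric_def
  by (rule eq_matI) (use assms(1) in \<open>auto intro!: assms(2)\<close>)

lemma pf_perm_sum_pfaffian:
  assumes "A \<in> carrier_mat (2 * m) (2 * m)" "skew_symmetric A"
  shows "pf_perm_sum m (\<lambda>i j. A $$ (i, j)) = of_nat (2 ^ m * fact m) * pfaffian A"
  by (rule pf_perm_sum_eq_pfaffian[OF _ skew_symmetricD[OF assms(2,1)]]) (use assms(1) in auto)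

lemma pfaff_adjugate_diag: "i < dim_row A \<Longrightarrow> i < dim_col A \<Longrightarrow> pfaff_adjugate A $$ (i, i) = 0"
  by (simp add: pfaff_adjugate_def)

text \<open>Each term of the permutation sum has exactly one factor whose pair contains i.
  Distinguishing that factor changes nothing, and grouping by its values gives the
  expansion.\<close>

lemma pfaffian_row_expansion:
  fixes A :: "'a::torsion_free_ring mat"
  assumes A: "A \<in> carrier_mat (2 * m) (2 * m)" and sk: "skew_symmetric A" and i: "i < 2 * m"
  shows "pfaffian A = (\<Sum>y<2 * m. A $$ (i, y) * pfaff_adjugate A $$ (y, i))"
proof -
  obtain l where m: "m = Suc l" using i by (cases m) auto
  let ?n = "2 * Suc l"
  have A': "A \<in> carrier_mat ?n ?n" using A m by simp
  have i': "i < ?n" using i m by simp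
  note skew = skew_symmetricD[OF sk A']
  let ?b = "pfaff_adjugate A"
  \<comment> \<open>Supported on row and column i, since i may be the first or the second element of
    its pair.\<close>
  define g where "g x y = (if x = i \<or> y = i then A $$ (x, y) else 0)" for x y
  have one: "(\<Sum>k<Suc l. g (\<sigma> (2 * k)) (\<sigma> (2 * k + 1))
        * (\<Prod>j\<in>{..<Suc l} - {k}. A $$ (\<sigma> (2 * j), \<sigma> (2 * j + 1))))
      = (\<Prod>j<Suc l. A $$ (\<sigma> (2 * j), \<sigma> (2 * j + 1)))" if \<sigma>: "\<sigma> permutes {..<?n}" for \<sigma>
  proof -
    obtain z where z: "z < ?n" "\<sigma> z = i"
      using permutes_image[OF \<sigma>] i' by (metis imageE lessThan_iff)
    define k where "k = z div 2"
    have k: "k < Suc l" using z by (auto simp: k_def)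
    have zk: "z = 2 * k \<or> z = 2 * k + 1" by (auto simp: k_def)
    have iff: "\<sigma> (2 * j) = i \<or> \<sigma> (2 * j + 1) = i \<longleftrightarrow> j = k" for j
    proof -
      have "\<sigma> a = i \<longleftrightarrow> a = z" for a using permutes_inj[OF \<sigma>] z(2) by (auto simp: inj_eq)
      then show ?thesis using zk by presburger
    qed
    have "(\<Sum>j<Suc l. g (\<sigma> (2 * j)) (\<sigma> (2 * j + 1))
        * (\<Prod>j\<in>{..<Suc l} - {j}. A $$ (\<sigma> (2 * j), \<sigma> (2 * j + 1))))
      = (\<Sum>j<Suc l. if j = k then A $$ (\<sigma> (2 * k), \<sigma> (2 * k + 1))
        * (\<Prod>j\<in>{..<Suc l} - {k}. A $$ (\<sigma> (2 * j), \<sigma> (2 * j + 1))) else 0)"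
      unfolding g_def iff by (intro sum.cong[OF refl]) auto
    also have "\<dots> = A $$ (\<sigma> (2 * k), \<sigma> (2 * k + 1))
        * (\<Prod>j\<in>{..<Suc l} - {k}. A $$ (\<sigma> (2 * j), \<sigma> (2 * j + 1)))"
      using k by (subst sum.delta) auto
    also have "\<dots> = (\<Prod>j<Suc l. A $$ (\<sigma> (2 * j), \<sigma> (2 * j + 1)))"
      using k by (subst (2) prod.remove[of _ k]) auto
    finally show ?thesis .
  qed
  have "of_nat (2 ^ Suc l * fact (Suc l)) * pfaffian A = pf_perm_sum (Suc l) (\<lambda>i j. A $$ (i, j))"
    using pf_perm_sum_pfaffian[OF A' sk] by simp
  also have "\<dots> = (\<Sum>\<sigma> | \<sigma> permutes {..<2 * Suc l}. of_int (sign \<sigma>) *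
           (\<Sum>k<Suc l. g (\<sigma> (2 * k)) (\<sigma> (2 * k + 1))
              * (\<Prod>j\<in>{..<Suc l} - {k}. A $$ (\<sigma> (2 * j), \<sigma> (2 * j + 1)))))"
    unfolding pf_perm_sum_def by (intro sum.cong[OF refl]) (simp only: one mem_Collect_eq)
  also have "\<dots> = of_nat (2 ^ l * fact (Suc l)) * (\<Sum>x<?n. \<Sum>y<?n. g x y * ?b $$ (y, x))"
    by (rule sum_permutes_distinguished_pair[OF A' skew])
  also have "(\<Sum>x<?n. \<Sum>y<?n. g x y * ?b $$ (y, x))
      = (\<Sum>x<?n. \<Sum>y<?n. (if x = i then A $$ (i, y) * ?b $$ (y, i) else 0)
                     + (if y = i then A $$ (i, x) * ?b $$ (x, i) else 0))"
  proof (intro sum.cong refl)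
    fix x y assume "x \<in> {..<?n}" "y \<in> {..<?n}"
    then have xy: "x < ?n" "y < ?n" by auto
    \<comment> \<open>In the column term the signs of A and Padj cancel. The corner x = y = i meets
      both conditions, but Padj is zero there.\<close>
    show "g x y * ?b $$ (y, x) = (if x = i then A $$ (i, y) * ?b $$ (y, i) else 0)
                     + (if y = i then A $$ (i, x) * ?b $$ (x, i) else 0)"
      using skew[OF i' xy(1)] pfaff_adjugate_skew[OF A' xy(1) i'] pfaff_adjugate_diag[of i A] A' i'
      by (auto simp: g_def)
  qed
  also have "\<dots> = of_nat 2 * (\<Sum>y<?n. A $$ (i, y) * ?b $$ (y, i))"
  proof -
    have "(\<Sum>x<?n. \<Sum>y<?n. if x = i then A $$ (i, y) * ?b $$ (y, i) else 0)
        = (\<Sum>y<?n. A $$ (i, y) * ?b $$ (y, i))"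
      using i' by (subst sum.swap) (simp add: sum.delta del: sum.lessThan_Suc)
    moreover have "(\<Sum>x<?n. \<Sum>y<?n. if y = i then A $$ (i, x) * ?b $$ (x, i) else 0)
        = (\<Sum>y<?n. A $$ (i, y) * ?b $$ (y, i))"
      using i' by (simp add: sum.delta del: sum.lessThan_Suc)
    ultimately show ?thesis unfolding sum.distrib by simp
  qed
  \<comment> \<open>The equal contributions of row and column supply the factor by which 2^(l + 1)
    exceeds 2^l.\<close>
  also have "of_nat (2 ^ l * fact (Suc l)) * (of_nat 2 * (\<Sum>y<?n. A $$ (i, y) * ?b $$ (y, i)))
     = of_nat (2 ^ Suc l * fact (Suc l)) * (\<Sum>y<?n. A $$ (i, y) * ?b $$ (y, i))"
    by (simp add: algebra_simps del: sum.lessThan_Suc)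
  finally show ?thesis
    unfolding m by (rule of_nat_mult_left_cancel[rotated]) simp
qed

text \<open>The rule pf(P A P^T) = det(P) pf(A) for a permutation matrix P, obtained by composing on
  the left with \<tau>.\<close>

lemma pf_perm_sum_permute:
  assumes \<tau>: "\<tau> permutes {..<2 * m}"
  shows "pf_perm_sum m (\<lambda>i j. a (\<tau> i) (\<tau> j)) = of_int (sign \<tau>) * pf_perm_sum m a"
proof -
  have perm: "permutation \<sigma>" if "\<sigma> permutes {..<2 * m}" for \<sigma>
    using that by (rule permutes_imp_permutation[OF finite_lessThan])
  have "pf_perm_sum m a = (\<Sum>\<sigma> | \<sigma> permutes {..<2 * m}. of_int (sign (\<tau> \<circ> \<sigma>)) *
      (\<Prod>k<m. a ((\<tau> \<circ> \<sigma>) (2 * k)) ((\<tau> \<circ> \<sigma>) (2 * k + 1))))"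
    unfolding pf_perm_sum_def by (rule setum_permutations_compose_left[OF \<tau>])
  also have "\<dots> = (\<Sum>\<sigma> | \<sigma> permutes {..<2 * m}. of_int (sign \<tau>) * (of_int (sign \<sigma>) *
      (\<Prod>k<m. a (\<tau> (\<sigma> (2 * k))) (\<tau> (\<sigma> (2 * k + 1))))))"
    using perm perm[OF \<tau>] by (intro sum.cong[OF refl]) (simp add: sign_compose mult.assoc)
  also have "\<dots> = of_int (sign \<tau>) * pf_perm_sum m (\<lambda>i j. a (\<tau> i) (\<tau> j))"
    unfolding pf_perm_sum_def by (simp only: sum_distrib_left)
  finally have "of_int (sign \<tau>) * pf_perm_sum m a
      = of_int (sign \<tau> * sign \<tau>) * pf_perm_sum m (\<lambda>i j. a (\<tau> i) (\<tau> j))"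
    by (simp only: of_int_mult mult.assoc)
  then show ?thesis by simp
qed

text \<open>Exchanging i and k fixes the matrix but negates the permutation sum, so twice the sum is
  zero and absence of torsion finishes.\<close>

lemma pfaffian_equal_rows:
  fixes A :: "'a::torsion_free_ring mat"
  assumes A: "A \<in> carrier_mat (2 * m) (2 * m)" and sk: "skew_symmetric A"
    and ik: "i < 2 * m" "k < 2 * m" "i \<noteq> k"
    and sym: "\<And>x y. x < 2 * m \<Longrightarrow> y < 2 * m \<Longrightarrow> A $$ (transpose i k x, transpose i k y) = A $$ (x, y)"
  shows "pfaffian A = 0"
proof -
  let ?\<tau> = "transpose i k"
  have \<tau>: "?\<tau> permutes {..<2 * m}" using ik by (intro permutes_swap_id) auto
  have "pf_perm_sum m (\<lambda>x y. A $$ (?\<tau> x, ?\<tau> y)) = pf_perm_sum m (\<lambda>x y. A $$ (x, y))"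
    unfolding pf_perm_sum_def
  proof (intro sum.cong[OF refl] arg_cong2[where f = "(*)"] prod.cong refl)
    fix \<sigma> j assume "\<sigma> \<in> {\<sigma>. \<sigma> permutes {..<2 * m}}" "j \<in> {..<m}"
    then have "\<sigma> (2 * j) < 2 * m" "\<sigma> (2 * j + 1) < 2 * m"
      using permutes_in_image[of \<sigma> "{..<2 * m}"] by auto
    then show "A $$ (?\<tau> (\<sigma> (2 * j)), ?\<tau> (\<sigma> (2 * j + 1))) = A $$ (\<sigma> (2 * j), \<sigma> (2 * j + 1))"
      by (rule sym)
  qed
  moreover have "pf_perm_sum m (\<lambda>x y. A $$ (?\<tau> x, ?\<tau> y)) = - pf_perm_sum m (\<lambda>x y. A $$ (x, y))"
    using pf_perm_sum_permute[OF \<tau>, of "\<lambda>x y. A $$ (x, y)"] ik(3) by (simp add: sign_swap_id)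
  ultimately have "pf_perm_sum m (\<lambda>x y. A $$ (x, y)) = - pf_perm_sum m (\<lambda>x y. A $$ (x, y))" by simp
  then have "of_nat 2 * (of_nat (2 ^ m * fact m) * pfaffian A) = 0"
    unfolding pf_perm_sum_pfaffian[OF A sk] by (simp only: eq_neg_iff_add_eq_0 of_nat_numeral mult_2)
  then show ?thesis
    by (meson of_nat_mult_eq_0 zero_less_numeral fact_gt_zero zero_less_power mult_pos_pos)
qed

text \<open>As for the classical adjugate: the diagonal is the row expansion, and an off-diagonal
  entry is the row expansion of a matrix in which row and column k were overwritten by row and
  column i.\<close>

lemma mult_pfaff_adjugate:
  fixes A :: "'a::torsion_free_ring mat"
  assumes A: "A \<in> carrier_mat (2 * m) (2 * m)" and sk: "skew_symmetric A"
  shows "A * pfaff_adjugate A = pfaffian A \<cdot>\<^sub>m 1\<^sub>m (2 * m)"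
proof (rule eq_matI)
  have dimP: "dim_row (pfaff_adjugate A) = 2 * m" "dim_col (pfaff_adjugate A) = 2 * m"
    using A by (auto simp: pfaff_adjugate_def)
  note skew = skew_symmetricD[OF sk A]
  fix i k assume "i < dim_row (pfaffian A \<cdot>\<^sub>m 1\<^sub>m (2 * m))" "k < dim_col (pfaffian A \<cdot>\<^sub>m 1\<^sub>m (2 * m))"
  then have ik: "i < 2 * m" "k < 2 * m" by auto
  have entry: "(A * pfaff_adjugate A) $$ (i, k) = (\<Sum>y<2 * m. A $$ (i, y) * pfaff_adjugate A $$ (y, k))"
    using A dimP ik by (simp add: scalar_prod_def atLeast0LessThan)
  show "(A * pfaff_adjugate A) $$ (i, k) = (pfaffian A \<cdot>\<^sub>m 1\<^sub>m (2 * m)) $$ (i, k)"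
  proof (cases "i = k")
    case True
    then show ?thesis using entry pfaffian_row_expansion[OF A sk ik(1)] ik by simp
  next
    case False
    \<comment> \<open>Reading the indices of A through \<open>f\<close> overwrites row and column
      simultaneously, which keeps the matrix skew-symmetric.\<close>
    define f where "f x = (if x = k then i else x)" for x
    define B where "B = mat (2 * m) (2 * m) (\<lambda>(x, y). A $$ (f x, f y))"
    have f: "f x < 2 * m" if "x < 2 * m" for x using that ik by (auto simp: f_def)
    have B: "B \<in> carrier_mat (2 * m) (2 * m)" by (simp add: B_def)
    have Bi: "B $$ (x, y) = A $$ (f x, f y)" if "x < 2 * m" "y < 2 * m" for x y
      using that by (simp add: B_def)
    have skB: "skew_symmetric B"
    proof (rule skew_symmetricI[OF B])
      fix x y assume "x < 2 * m" "y < 2 * m"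
      then show "B $$ (y, x) = - B $$ (x, y)" using skew[OF f f, of x y] by (simp add: Bi)
    qed
    have "pfaffian B = 0"
    proof (rule pfaffian_equal_rows[OF B skB ik False])
      fix x y assume "x < 2 * m" "y < 2 * m"
      moreover have "transpose i k z < 2 * m" if "z < 2 * m" for z
        using that ik by (auto simp: transpose_def)
      moreover have "f (transpose i k z) = f z" for z by (auto simp: transpose_def f_def)
      ultimately show "B $$ (transpose i k x, transpose i k y) = B $$ (x, y)" by (simp add: Bi)
    qed
    obtain l where m: "2 * m = Suc (Suc (2 * l))" using ik(1) by (cases m) auto
    have "B $$ (k, y) * pfaff_adjugate B $$ (y, k) = A $$ (i, y) * pfaff_adjugate A $$ (y, k)"
      if y: "y < 2 * m" for y
    proof (cases "y = k")
      case True
      then show ?thesis using A B ik by (simp add: pfaff_adjugate_diag)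
    next
      case False
      \<comment> \<open>These minors delete index k, the only place where B and A differ.\<close>
      have "remove_two B k y = remove_two A k y"
      proof (rule eq_matI)
        have dA: "remove_two A k y \<in> carrier_mat (2 * l) (2 * l)"
          and dB: "remove_two B k y \<in> carrier_mat (2 * l) (2 * l)"
          using remove_two_dim[OF A[unfolded m]] remove_two_dim[OF B[unfolded m]] ik y False
          unfolding m by auto
        then show "dim_row (remove_two B k y) = dim_row (remove_two A k y)"
          "dim_col (remove_two B k y) = dim_col (remove_two A k y)" by auto
        fix a b assume "a < dim_row (remove_two A k y)" "b < dim_col (remove_two A k y)"
        then have ab: "a < 2 * l" "b < 2 * l" using dA by auto
        have "f (skip_two k y c) = skip_two k y c" for c
          using skip_two_neq(1)[of k y c] False by (simp add: f_def)
        then show "remove_two B k y $$ (a, b) = remove_two A k y $$ (a, b)"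
          using remove_two_index[OF A[unfolded m], of k y a b] remove_two_index[OF B[unfolded m], of k y a b]
            Bi[of "skip_two k y a" "skip_two k y b"] skip_two_less[OF ab(1), of k y] skip_two_less[OF ab(2), of k y]
            ik(2) y False ab unfolding m by simp
      qed
      then show ?thesis
        using pfaff_adjugate_index[OF A ik(2) y] pfaff_adjugate_index[OF B ik(2) y] Bi[OF ik(2) y] False
        by (simp add: f_def)
    qed
    then have "(\<Sum>y<2 * m. A $$ (i, y) * pfaff_adjugate A $$ (y, k)) = pfaffian B"
      unfolding pfaffian_row_expansion[OF B skB ik(2)] by (intro sum.cong[OF refl]) simp
    then show ?thesis using entry \<open>pfaffian B = 0\<close> False ik by simp
  qed
qed (use A in \<open>auto simp: pfaff_adjugate_def\<close>)

section \<open>The derivative of the Pfaffian with respect to t\<close>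

text \<open>The derivative of a product of linear polynomials, coefficientwise (the library's
  \<open>pderiv\<close> needs a ring without zero divisors).\<close>
lemma coeff_prod_linear:
  fixes a b :: "'i \<Rightarrow> 'a::comm_ring_1"
  assumes "finite K"
  shows "of_nat (Suc r) * coeff (\<Prod>k\<in>K. [:a k, b k:]) (Suc r)
    = (\<Sum>k\<in>K. b k * coeff (\<Prod>j\<in>K - {k}. [:a j, b j:]) r)"
  using assms
proof (induction K arbitrary: r rule: finite_induct)
  case (insert x K)
  let ?P = "\<lambda>K. \<Prod>k\<in>K. [:a k, b k:]"
  have co: "coeff ([:c, d:] * p) r = c * coeff p r + (case r of 0 \<Rightarrow> 0 | Suc s \<Rightarrow> d * coeff p s)"
    for c d :: 'a and p r
    by (simp add: coeff_pCons split: nat.split)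
  have "(\<Sum>k\<in>insert x K. b k * coeff (?P (insert x K - {k})) r)
      = b x * coeff (?P K) r + (\<Sum>k\<in>K. b k * coeff ([:a x, b x:] * ?P (K - {k})) r)"
  proof -
    have "?P (insert x K - {k}) = [:a x, b x:] * ?P (K - {k})" if "k \<in> K" for k
      using insert that by (subst insert_Diff_if) auto
    then show ?thesis using insert by (simp add: insert_Diff_if)
  qed
  also have "(\<Sum>k\<in>K. b k * coeff ([:a x, b x:] * ?P (K - {k})) r)
      = a x * (\<Sum>k\<in>K. b k * coeff (?P (K - {k})) r)
        + (case r of 0 \<Rightarrow> 0 | Suc s \<Rightarrow> b x * (\<Sum>k\<in>K. b k * coeff (?P (K - {k})) s))"
    unfolding co by (cases r) (simp_all add: sum_distrib_left sum.distrib algebra_simps)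
  \<comment> \<open>The second summand is the induction hypothesis one degree lower; for r = 0 both
    the \<open>case\<close> expression and \<open>of_nat r\<close> vanish.\<close>
  also have "\<dots> = a x * (of_nat (Suc r) * coeff (?P K) (Suc r)) + b x * (of_nat r * coeff (?P K) r)"
    by (cases r) (simp_all add: insert.IH[symmetric])
  also have "b x * coeff (?P K) r + (a x * (of_nat (Suc r) * coeff (?P K) (Suc r)) + b x * (of_nat r * coeff (?P K) r))
      = of_nat (Suc r) * coeff ([:a x, b x:] * ?P K) (Suc r)"
    unfolding co by (simp add: algebra_simps)
  finally show ?case using insert by simp
qed simp

text \<open>The product rule replaces one factor of each term by its t-coefficient, an entry of J,
  so the distinguished-pair expansion applies with constant polynomials as \<open>g\<close>. The 2
  on the left is the quotient of 2^(l + 1) by 2^l.\<close>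

lemma coeff_pfaffian_linear:
  fixes A J :: "'a::torsion_free_ring mat"
  defines "B \<equiv> [:0, 1:] \<cdot>\<^sub>m map_mat (\<lambda>a. [:a:]) J + map_mat (\<lambda>a. [:a:]) A"
  assumes A: "A \<in> carrier_mat (2 * m) (2 * m)" and J: "J \<in> carrier_mat (2 * m) (2 * m)"
    and skB: "skew_symmetric B"
  shows "of_nat (2 * Suc r) * coeff (pfaffian B) (Suc r)
    = (\<Sum>x<2 * m. \<Sum>y<2 * m. J $$ (x, y) * coeff (pfaff_adjugate B $$ (y, x)) r)"
proof (cases m)
  case 0
  have B: "B \<in> carrier_mat 0 0" using A J 0 by (simp add: B_def)
  have "pf_perm_sum 0 (\<lambda>i j. B $$ (i, j)) = of_nat (2 ^ 0 * fact 0) * pfaffian B"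
    using B skB by (intro pf_perm_sum_pfaffian) auto
  then show ?thesis using 0 by (simp add: pf_perm_sum_def)
next
  case (Suc l)
  let ?n = "2 * Suc l"
  have B: "B \<in> carrier_mat ?n ?n" using A J Suc by (simp add: B_def)
  have Bi: "B $$ (x, y) = [:A $$ (x, y), J $$ (x, y):]" if "x < ?n" "y < ?n" for x y
    using A J Suc that by (simp add: B_def)
  have sp: "pf_perm_sum (Suc l) (\<lambda>i j. B $$ (i, j)) = of_nat (2 ^ Suc l * fact (Suc l)) * pfaffian B"
    by (rule pf_perm_sum_pfaffian[OF B skB])
  let ?c = "of_nat (Suc r) :: 'a"
  let ?S = "\<Sum>x<?n. \<Sum>y<?n. J $$ (x, y) * coeff (pfaff_adjugate B $$ (y, x)) r"
  have "of_nat (2 ^ Suc l * fact (Suc l)) * (?c * coeff (pfaffian B) (Suc r))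
      = ?c * coeff (pf_perm_sum (Suc l) (\<lambda>i j. B $$ (i, j))) (Suc r)"
    unfolding sp coeff_of_nat_mult by (simp only: mult_ac)
  also have "\<dots> = (\<Sum>\<sigma> | \<sigma> permutes {..<?n}. of_int (sign \<sigma>) *
      (?c * coeff (\<Prod>k<Suc l. B $$ (\<sigma> (2 * k), \<sigma> (2 * k + 1))) (Suc r)))"
    unfolding pf_perm_sum_def coeff_sum coeff_of_int_mult sum_distrib_left by (simp only: mult_ac)
  also have "\<dots> = (\<Sum>\<sigma> | \<sigma> permutes {..<?n}. of_int (sign \<sigma>) *
      coeff (\<Sum>k<Suc l. [:J $$ (\<sigma> (2 * k), \<sigma> (2 * k + 1)):] *
        (\<Prod>j\<in>{..<Suc l} - {k}. B $$ (\<sigma> (2 * j), \<sigma> (2 * j + 1)))) r)"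
  proof (intro sum.cong[OF refl] arg_cong2[where f = "(*)"] refl)
    fix \<sigma> assume "\<sigma> \<in> {\<sigma>. \<sigma> permutes {..<?n}}"
    then have \<sigma>: "\<sigma> permutes {..<?n}" by simp
    have lt: "\<sigma> x < ?n" if "x < ?n" for x using permutes_in_image[OF \<sigma>, of x] that by simp
    have e: "B $$ (\<sigma> (2 * k), \<sigma> (2 * k + 1))
        = [:A $$ (\<sigma> (2 * k), \<sigma> (2 * k + 1)), J $$ (\<sigma> (2 * k), \<sigma> (2 * k + 1)):]"
      if "k < Suc l" for k
      using that by (intro Bi lt) auto
    have "(\<Prod>k\<in>K. B $$ (\<sigma> (2 * k), \<sigma> (2 * k + 1)))
        = (\<Prod>k\<in>K. [:A $$ (\<sigma> (2 * k), \<sigma> (2 * k + 1)), J $$ (\<sigma> (2 * k), \<sigma> (2 * k + 1)):])"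
      if "K \<subseteq> {..<Suc l}" for K
      using that e by (intro prod.cong[OF refl]) auto
    note pe = this[of "{..<Suc l}", OF order_refl] this[of "{..<Suc l} - {k}" for k, OF Diff_subset]
    show "?c * coeff (\<Prod>k<Suc l. B $$ (\<sigma> (2 * k), \<sigma> (2 * k + 1))) (Suc r)
        = coeff (\<Sum>k<Suc l. [:J $$ (\<sigma> (2 * k), \<sigma> (2 * k + 1)):] *
        (\<Prod>j\<in>{..<Suc l} - {k}. B $$ (\<sigma> (2 * j), \<sigma> (2 * j + 1)))) r"
      unfolding pe coeff_prod_linear[OF finite_lessThan] coeff_sum by simp
  qed
  also have "\<dots> = coeff (\<Sum>\<sigma> | \<sigma> permutes {..<?n}. of_int (sign \<sigma>) *
      (\<Sum>k<Suc l. [:J $$ (\<sigma> (2 * k), \<sigma> (2 * k + 1)):] *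
        (\<Prod>j\<in>{..<Suc l} - {k}. B $$ (\<sigma> (2 * j), \<sigma> (2 * j + 1))))) r"
    by (simp only: coeff_sum coeff_of_int_mult)
  also have "\<dots> = of_nat (2 ^ l * fact (Suc l)) * ?S"
    by (subst sum_permutes_distinguished_pair[OF B skew_symmetricD[OF skB B],
          where g = "\<lambda>x y. [:J $$ (x, y):]"])
      (simp_all only: coeff_of_nat_mult coeff_sum mult_pCons_left pCons_0_0 add_0_right coeff_smult
         mult_zero_left)
  finally have "of_nat (2 ^ l * fact (Suc l)) * (of_nat (2 * Suc r) * coeff (pfaffian B) (Suc r))
      = of_nat (2 ^ l * fact (Suc l)) * ?S"
    by (simp add: algebra_simps del: sum.lessThan_Suc)
  then show ?thesis unfolding Suc by (rule of_nat_mult_left_cancel[rotated]) simp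
qed

section \<open>The recursion for the coefficients\<close>

lemma J_mat_carrier: "J_mat m \<in> carrier_mat (2 * m) (2 * m)"
  by (rule carrier_matI) (simp_all add: J_mat_def dim_diag_block_mat mat_of_rows_list_def sum_list_replicate)

lemma J_mat_index:
  assumes "i < 2 * m" "j < 2 * m"
  shows "J_mat m $$ (i, j) = (if even i \<and> j = Suc i then 1 else if even j \<and> i = Suc j then -1 else 0)"
  using assms
proof (induction m arbitrary: i j)
  case (Suc m)
  define X :: "'a mat" where "X = mat_of_rows_list 2 [[0, 1], [-1, 0]]"
  have X: "X \<in> carrier_mat 2 2" by (rule carrier_matI) (simp_all add: X_def mat_of_rows_list_def)
  have J: "(J_mat m :: 'a mat) \<in> carrier_mat (2 * m) (2 * m)" by (rule J_mat_carrier)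
  have e: "(J_mat (Suc m) :: 'a mat) = four_block_mat X (0\<^sub>m 2 (2 * m)) (0\<^sub>m (2 * m) 2) (J_mat m)"
    using J X by (simp add: J_mat_def X_def[symmetric] Let_def)
  have Xi: "X $$ (0, 0) = 0" "X $$ (0, Suc 0) = 1" "X $$ (Suc 0, 0) = -1" "X $$ (Suc 0, Suc 0) = 0"
    by (simp_all add: X_def mat_of_rows_list_def)
  have idx: "(J_mat (Suc m) :: 'a mat) $$ (i, j) = (if i < 2 then if j < 2 then X $$ (i, j) else 0
      else if j < 2 then 0 else J_mat m $$ (i - 2, j - 2))"
    unfolding e using Suc.prems X J by (subst index_mat_four_block) auto
  consider "i < 2" "j < 2" | "i < 2" "\<not> j < 2" | "\<not> i < 2" "j < 2" | "\<not> i < 2" "\<not> j < 2" by blast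
  then show ?case
  proof cases
    case 1
    then show ?thesis unfolding idx using Xi by (auto simp: less_2_cases_iff)
  next
    case 4
    then obtain i' j' where ij: "i = Suc (Suc i')" "j = Suc (Suc j')"
      by (metis add_2_eq_Suc le_Suc_ex not_less)
    then show ?thesis unfolding idx using Suc.IH[of i' j'] Suc.prems by simp
  qed (unfold idx, auto simp: less_2_cases_iff)
qed simp

lemma J_mat_skew: "skew_symmetric (J_mat m)"
  by (rule skew_symmetricI[OF J_mat_carrier]) (auto simp: J_mat_index)

lemma J_mat_mult_J_mat: "J_mat m * J_mat m = - 1\<^sub>m (2 * m)"
proof (rule eq_matI)
  let ?J = "J_mat m :: 'a mat"
  fix i j assume "i < dim_row (- 1\<^sub>m (2 * m) :: 'a mat)" "j < dim_col (- 1\<^sub>m (2 * m) :: 'a mat)"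
  then have ij: "i < 2 * m" "j < 2 * m" by auto
  \<comment> \<open>The partner of i, the only column where row i of J is nonzero.\<close>
  define p where "p = (if even i then Suc i else i - 1)"
  have p: "p < 2 * m" using ij by (auto simp: p_def elim!: evenE)
  have "(?J * ?J) $$ (i, j) = (\<Sum>k<2 * m. ?J $$ (i, k) * ?J $$ (k, j))"
    using J_mat_carrier[of m, where 'a = 'a] ij by (simp add: scalar_prod_def atLeast0LessThan)
  also have "\<dots> = (\<Sum>k<2 * m. if k = p then ?J $$ (i, p) * ?J $$ (p, j) else 0)"
    using ij by (intro sum.cong[OF refl]) (auto simp: J_mat_index p_def)
  also have "\<dots> = ?J $$ (i, p) * ?J $$ (p, j)" using p by (subst sum.delta) auto
  also have "\<dots> = (- 1\<^sub>m (2 * m)) $$ (i, j)"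
    unfolding J_mat_index[OF ij(1) p] J_mat_index[OF p ij(2)]
    using ij by (auto simp: p_def elim!: oddE) presburger
  finally show "(?J * ?J) $$ (i, j) = (- 1\<^sub>m (2 * m)) $$ (i, j)" .
qed (use J_mat_carrier[of m, where 'a = 'a] in auto)

text \<open>Expansion along row 2m, the first row of the last block: only the entry in column 2m + 1
  survives, and its minor is the next smaller J.\<close>

lemma pfaffian_J_mat: "pfaffian (J_mat m :: 'a::torsion_free_ring mat) = 1"
proof (induction m)
  case 0
  have "pf_perm_sum 0 (\<lambda>i j. (J_mat 0 :: 'a mat) $$ (i, j)) = of_nat (2 ^ 0 * fact 0) * pfaffian (J_mat 0 :: 'a mat)"
    using J_mat_carrier J_mat_skew by (rule pf_perm_sum_pfaffian)
  then show ?case by (simp add: pf_perm_sum_def)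
next
  case (Suc m)
  let ?J = "J_mat (Suc m) :: 'a mat"
  let ?n = "2 * Suc m"
  have J: "?J \<in> carrier_mat (Suc (Suc (2 * m))) (Suc (Suc (2 * m)))"
    using J_mat_carrier[of "Suc m", where 'a = 'a] by simp
  have J': "(J_mat m :: 'a mat) \<in> carrier_mat (2 * m) (2 * m)" by (rule J_mat_carrier)
  have R: "remove_two ?J (2 * m) (Suc (2 * m)) = J_mat m"
  proof (rule eq_matI)
    have dR: "remove_two ?J (2 * m) (Suc (2 * m)) \<in> carrier_mat (2 * m) (2 * m)"
      by (rule remove_two_dim[OF J]) auto
    then show "dim_row (remove_two ?J (2 * m) (Suc (2 * m))) = dim_row (J_mat m :: 'a mat)"
      "dim_col (remove_two ?J (2 * m) (Suc (2 * m))) = dim_col (J_mat m :: 'a mat)"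
      using J' by auto
    fix a b assume "a < dim_row (J_mat m :: 'a mat)" "b < dim_col (J_mat m :: 'a mat)"
    then have ab: "a < 2 * m" "b < 2 * m" using J' by auto
    have s: "skip_two (2 * m) (Suc (2 * m)) c = c" if "c < 2 * m" for c
      using that by (simp add: skip_two_def delete_index_def insert_index_def)
    show "remove_two ?J (2 * m) (Suc (2 * m)) $$ (a, b) = J_mat m $$ (a, b)"
      using remove_two_index[OF J, of "2 * m" "Suc (2 * m)" a b] ab
      by (simp add: s J_mat_index)
  qed
  have "pfaffian ?J = (\<Sum>y<?n. ?J $$ (2 * m, y) * pfaff_adjugate ?J $$ (y, 2 * m))"
    using J_mat_carrier J_mat_skew by (rule pfaffian_row_expansion) simp
  also have "\<dots> = (\<Sum>y<?n. if y = Suc (2 * m) then pfaff_adjugate ?J $$ (Suc (2 * m), 2 * m) else 0)"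
  proof (rule sum.cong[OF refl])
    fix y assume "y \<in> {..<?n}"
    then have y: "y < ?n" by simp
    have m: "2 * m < ?n" by simp
    show "?J $$ (2 * m, y) * pfaff_adjugate ?J $$ (y, 2 * m)
        = (if y = Suc (2 * m) then pfaff_adjugate ?J $$ (Suc (2 * m), 2 * m) else 0)"
      unfolding J_mat_index[OF m y] using y by (auto, presburger)
  qed
  also have "\<dots> = pfaff_adjugate ?J $$ (Suc (2 * m), 2 * m)" by (subst sum.delta) auto
  also have "\<dots> = pfaffian (remove_two ?J (2 * m) (Suc (2 * m)))"
    by (subst pfaff_adjugate_index[OF J]) (auto simp: minus_one_power_iff)
  finally show ?case using R Suc.IH by simp
qed

section \<open>Leading and constant coefficients\<close>

lemma coeff_linear_mult:
  "coeff ([:c, d:] * p) s = c * coeff p s + (if s = 0 then 0 else d * coeff p (s - 1))"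
  for c d :: "'a::comm_ring_1"
  by (cases s) (simp_all add: coeff_pCons)

text \<open>Phrased by coefficients rather than by \<open>degree\<close>, since the product of the
  \<open>b k\<close> may be zero.\<close>

lemma prod_linear_top:
  fixes a b :: "'i \<Rightarrow> 'a::comm_ring_1"
  assumes "finite K"
  shows "coeff (\<Prod>k\<in>K. [:a k, b k:]) (card K) = (\<Prod>k\<in>K. b k)
    \<and> (\<forall>s>card K. coeff (\<Prod>k\<in>K. [:a k, b k:]) s = 0)"
  using assms
proof (induction K rule: finite_induct)
  case (insert x K)
  then show ?case by (auto simp: coeff_linear_mult simp del: mult_pCons_left)
qed auto

lemma card_perfect_matching:
  assumes "P \<in> perfect_matchings (2 * m)"
  shows "card P = m" "finite P"
proof -
  let ?\<sigma> = "matching_enum (2 * m) P"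
  have "inj_on (\<lambda>k. {?\<sigma> (2 * k), ?\<sigma> (2 * k + 1)}) {..<m}"
    using inj_matching_of[OF matching_enum_permutes(1)[OF assms]] by (rule inj_on_subset) simp
  then have "card (matching_of m ?\<sigma>) = m" unfolding matching_of_def by (simp add: card_image)
  then show "card P = m" using matching_enum_permutes(2)[OF assms] by simp
  have "finite (matching_of m ?\<sigma>)" by (simp add: matching_of_def)
  then show "finite P" using matching_enum_permutes(2)[OF assms] by simp
qed

lemma perfect_matching_edge:
  assumes "P \<in> perfect_matchings n" "e \<in> P"
  shows "Min e < n" "Max e < n"
proof -
  have "e \<subseteq> {..<n}" "card e = 2"
    using assms by (auto simp: perfect_matchings_def partition_on_def)
  then have "finite e" "e \<noteq> {}" by (auto intro: finite_subset)
  then show "Min e < n" "Max e < n" using \<open>e \<subseteq> {..<n}\<close> by (auto dest: Min_in Max_in)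
qed

text \<open>Read off the matching sum itself: each term is a product of m polynomials that are
  linear in t.\<close>

lemma pfaffian_linear_top:
  fixes A J :: "'a::comm_ring_1 mat"
  assumes dim: "dim_row B = 2 * m" "dim_row J = 2 * m"
    and B: "\<And>i j. i < 2 * m \<Longrightarrow> j < 2 * m \<Longrightarrow> B $$ (i, j) = [:A $$ (i, j), J $$ (i, j):]"
  shows "coeff (pfaffian B) m = pfaffian J" and "m < s \<Longrightarrow> coeff (pfaffian B) s = 0"
proof -
  have pr: "(\<Prod>e\<in>P. B $$ (Min e, Max e)) = (\<Prod>e\<in>P. [:A $$ (Min e, Max e), J $$ (Min e, Max e):])"
    if "P \<in> perfect_matchings (2 * m)" for P
    using perfect_matching_edge[OF that] by (intro prod.cong[OF refl] B) auto
  have top: "coeff (\<Prod>e\<in>P. B $$ (Min e, Max e)) m = (\<Prod>e\<in>P. J $$ (Min e, Max e))"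
    "m < s \<Longrightarrow> coeff (\<Prod>e\<in>P. B $$ (Min e, Max e)) s = 0"
    if P: "P \<in> perfect_matchings (2 * m)" for P s
    unfolding pr[OF P]
    using prod_linear_top[OF card_perfect_matching(2)[OF P], of "\<lambda>e. A $$ (Min e, Max e)" "\<lambda>e. J $$ (Min e, Max e)"]
      card_perfect_matching(1)[OF P] by auto
  show "coeff (pfaffian B) m = pfaffian J"
    unfolding pfaffian_def dim coeff_sum coeff_of_int_mult by (intro sum.cong[OF refl]) (simp add: top)
  show "coeff (pfaffian B) s = 0" if "m < s"
    unfolding pfaffian_def dim coeff_sum coeff_of_int_mult using that by (intro sum.neutral) (simp add: top)
qed

text \<open>Evaluation at t = 0 is a ring homomorphism, and the Pfaffian is a polynomial in the
  entries with integer coefficients.\<close>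

lemma coeff_0_pfaffian:
  fixes B :: "'a::comm_ring_1 poly mat"
  assumes dim: "dim_row A = dim_row B"
    and A: "\<And>i j. i < dim_row B \<Longrightarrow> j < dim_row B \<Longrightarrow> A $$ (i, j) = coeff (B $$ (i, j)) 0"
  shows "coeff (pfaffian B) 0 = pfaffian A"
proof -
  have p: "coeff (\<Prod>e\<in>P. f e) 0 = (\<Prod>e\<in>P. coeff (f e) 0)" for P and f :: "nat set \<Rightarrow> 'a poly"
    by (simp add: poly_0_coeff_0[symmetric] poly_prod)
  show ?thesis
    unfolding pfaffian_def coeff_sum coeff_of_int_mult p dim
    using perfect_matching_edge
    by (intro sum.cong[OF refl] arg_cong2[where f = "(*)"] prod.cong refl A[symmetric]) blast+
qed

section \<open>Coefficients of Padj(tJ + A) and pf(tJ + A)\<close>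

lemma mat_trace_add:
  assumes "X \<in> carrier_mat n n" "Y \<in> carrier_mat n n"
  shows "mat_trace (X + Y) = mat_trace X + mat_trace Y"
  using assms by (simp add: mat_trace_def sum.distrib)

lemma mat_trace_mult:
  assumes "X \<in> carrier_mat n n" "Y \<in> carrier_mat n n"
  shows "mat_trace (X * Y) = (\<Sum>i<n. \<Sum>j<n. X $$ (i, j) * Y $$ (j, i))"
  using assms by (simp add: mat_trace_def scalar_prod_def atLeast0LessThan)

definition padj_coeff :: "'a::comm_ring_1 mat \<Rightarrow> nat \<Rightarrow> nat \<Rightarrow> 'a mat" where
  "padj_coeff A m s = map_mat (\<lambda>p. coeff p s)
     (pfaff_adjugate ([:0, 1:] \<cdot>\<^sub>m map_mat (\<lambda>a. [:a:]) (J_mat m) + map_mat (\<lambda>a. [:a:]) A))"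

definition pf_coeff :: "'a::comm_ring_1 mat \<Rightarrow> nat \<Rightarrow> nat \<Rightarrow> 'a" where
  "pf_coeff A m s =
     coeff (pfaffian ([:0, 1:] \<cdot>\<^sub>m map_mat (\<lambda>a. [:a:]) (J_mat m) + map_mat (\<lambda>a. [:a:]) A)) s"

context
  fixes A :: "'a::torsion_free_ring mat" and m :: nat and B :: "'a poly mat"
  assumes A: "A \<in> carrier_mat (2 * m) (2 * m)" and sk: "skew_symmetric A"
  defines "B \<equiv> [:0, 1:] \<cdot>\<^sub>m map_mat (\<lambda>a. [:a:]) (J_mat m) + map_mat (\<lambda>a. [:a:]) A"
begin

lemma B_carrier: "B \<in> carrier_mat (2 * m) (2 * m)"
  using A J_mat_carrier[of m, where 'a = 'a] by (simp add: B_def)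

lemma B_index: "i < 2 * m \<Longrightarrow> j < 2 * m \<Longrightarrow> B $$ (i, j) = [:A $$ (i, j), J_mat m $$ (i, j):]"
  using A J_mat_carrier[of m, where 'a = 'a] by (simp add: B_def)

lemma B_skew: "skew_symmetric B"
proof (rule skew_symmetricI[OF B_carrier])
  fix i j assume ij: "i < 2 * m" "j < 2 * m"
  have "J_mat m $$ (j, i) = - (J_mat m $$ (i, j) :: 'a)"
    by (rule skew_symmetricD[OF J_mat_skew J_mat_carrier ij])
  then show "B $$ (j, i) = - B $$ (i, j)"
    using skew_symmetricD[OF sk A ij] ij by (simp add: B_index)
qed

lemma padj_carrier: "pfaff_adjugate B \<in> carrier_mat (2 * m) (2 * m)"
  using B_carrier by (auto simp: pfaff_adjugate_def)

lemma padj_coeff_carrier: "padj_coeff A m s \<in> carrier_mat (2 * m) (2 * m)"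
  using padj_carrier by (simp add: padj_coeff_def B_def)

lemma padj_coeff_index:
  "i < 2 * m \<Longrightarrow> j < 2 * m \<Longrightarrow> padj_coeff A m s $$ (i, j) = coeff (pfaff_adjugate B $$ (i, j)) s"
  using padj_carrier by (simp add: padj_coeff_def B_def)

text \<open>Compare coefficients of \<open>t^s\<close> in \<open>B * pfaff_adjugate B\<close>. The
  zero matrix at s = 0 stands for the absent coefficient of index -1.\<close>

lemma padj_coeff_relation:
  "A * padj_coeff A m s + J_mat m * (if s = 0 then 0\<^sub>m (2 * m) (2 * m) else padj_coeff A m (s - 1))
     = pf_coeff A m s \<cdot>\<^sub>m 1\<^sub>m (2 * m)" (is "?L = ?R")
proof (rule eq_matI)
  note J = J_mat_carrier[of m, where 'a = 'a]
  let ?M = "if s = 0 then 0\<^sub>m (2 * m) (2 * m) else padj_coeff A m (s - 1)"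
  have M: "?M \<in> carrier_mat (2 * m) (2 * m)" using padj_coeff_carrier by simp
  fix i k assume "i < dim_row ?R" "k < dim_col ?R"
  then have ik: "i < 2 * m" "k < 2 * m" by auto
  have "?L $$ (i, k) = (\<Sum>y<2 * m. A $$ (i, y) * padj_coeff A m s $$ (y, k))
      + (\<Sum>y<2 * m. J_mat m $$ (i, y) * ?M $$ (y, k))"
    using A J M padj_coeff_carrier[of s] ik
    by (simp add: scalar_prod_def atLeast0LessThan del: if_split)
  also have "\<dots> = (\<Sum>y<2 * m. coeff (B $$ (i, y) * pfaff_adjugate B $$ (y, k)) s)"
    unfolding sum.distrib[symmetric]
  proof (rule sum.cong[OF refl])
    fix y assume "y \<in> {..<2 * m}"
    then have y: "y < 2 * m" by simp
    show "A $$ (i, y) * padj_coeff A m s $$ (y, k) + J_mat m $$ (i, y) * ?M $$ (y, k)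
        = coeff (B $$ (i, y) * pfaff_adjugate B $$ (y, k)) s"
      unfolding B_index[OF ik(1) y] coeff_linear_mult padj_coeff_index[OF y ik(2)]
      using y ik by (simp add: padj_coeff_index)
  qed
  also have "\<dots> = coeff ((B * pfaff_adjugate B) $$ (i, k)) s"
    using B_carrier padj_carrier ik by (simp add: coeff_sum scalar_prod_def atLeast0LessThan)
  also have "\<dots> = coeff (if i = k then pfaffian B else 0) s"
    unfolding mult_pfaff_adjugate[OF B_carrier B_skew] using ik by simp
  also have "\<dots> = ?R $$ (i, k)" using ik by (simp add: pf_coeff_def B_def)
  finally show "?L $$ (i, k) = ?R $$ (i, k)" .
qed (use A J_mat_carrier[of m, where 'a = 'a] padj_coeff_carrier in auto)

lemma trace_J_padj_coeff:
  "mat_trace (J_mat m * padj_coeff A m s) = of_nat (2 * Suc s) * pf_coeff A m (Suc s)"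
proof -
  have "mat_trace (J_mat m * padj_coeff A m s)
      = (\<Sum>x<2 * m. \<Sum>y<2 * m. J_mat m $$ (x, y) * coeff (pfaff_adjugate B $$ (y, x)) s)"
    unfolding mat_trace_mult[OF J_mat_carrier padj_coeff_carrier]
    by (intro sum.cong[OF refl]) (simp add: padj_coeff_index)
  also have "\<dots> = of_nat (2 * Suc s) * coeff (pfaffian B) (Suc s)"
    using coeff_pfaffian_linear[OF A J_mat_carrier B_skew[unfolded B_def], of s] by (simp only: B_def)
  finally show ?thesis by (simp only: pf_coeff_def B_def)
qed

lemma trace_A_padj_coeff:
  assumes "s \<le> m"
  shows "mat_trace (A * padj_coeff A m s) = of_nat (2 * (m - s)) * pf_coeff A m s"
proof -
  let ?M = "if s = 0 then 0\<^sub>m (2 * m) (2 * m) else padj_coeff A m (s - 1)"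
  have M: "?M \<in> carrier_mat (2 * m) (2 * m)" using padj_coeff_carrier by simp
  have JM: "mat_trace (J_mat m * ?M) = of_nat (2 * s) * pf_coeff A m s"
  proof (cases s)
    case 0
    then show ?thesis using J_mat_carrier[of m, where 'a = 'a] by (simp add: mat_trace_def)
  qed (use trace_J_padj_coeff in simp)
  have "mat_trace (A * padj_coeff A m s) + mat_trace (J_mat m * ?M)
      = mat_trace (pf_coeff A m s \<cdot>\<^sub>m 1\<^sub>m (2 * m))"
    unfolding padj_coeff_relation[symmetric]
    by (rule mat_trace_add[symmetric,
          OF mult_carrier_mat[OF A padj_coeff_carrier] mult_carrier_mat[OF J_mat_carrier M]])
  also have "\<dots> = of_nat (2 * m) * pf_coeff A m s" by (simp add: mat_trace_def)
  finally show ?thesis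
    \<comment> \<open>The trace of the right-hand side is 2m times the coefficient; subtracting the
      part 2s of J leaves 2(m - s), where s \<le> m makes the natural subtraction exact.\<close>
    unfolding JM using assms by (simp add: of_nat_diff algebra_simps)
qed

lemma pf_coeff_top: "pf_coeff A m m = 1" "m < s \<Longrightarrow> pf_coeff A m s = 0"
proof -
  have d: "dim_row B = 2 * m" "dim_row (J_mat m :: 'a mat) = 2 * m"
    using B_carrier J_mat_carrier[of m, where 'a = 'a] by auto
  show "pf_coeff A m m = 1"
    using pfaffian_linear_top(1)[OF d B_index] by (simp add: pf_coeff_def B_def pfaffian_J_mat)
  show "m < s \<Longrightarrow> pf_coeff A m s = 0"
    using pfaffian_linear_top(2)[OF d B_index] by (simp add: pf_coeff_def B_def)
qed

lemma pf_coeff_0: "pf_coeff A m 0 = pfaffian A"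
  unfolding pf_coeff_def B_def[symmetric]
  using A B_carrier by (intro coeff_0_pfaffian) (auto simp: B_index)

text \<open>The off-diagonal entries are, up to sign, Pfaffians of minors of size 2(m - 1), hence of
  degree at most m - 1 in t.\<close>

lemma padj_coeff_eq_0:
  assumes "m \<le> s"
  shows "padj_coeff A m s = 0\<^sub>m (2 * m) (2 * m)"
proof (rule eq_matI)
  fix i j assume "i < dim_row (0\<^sub>m (2 * m) (2 * m))" "j < dim_col (0\<^sub>m (2 * m) (2 * m))"
  then have ij: "i < 2 * m" "j < 2 * m" by auto
  obtain l where m: "m = Suc l" using ij by (cases m) auto
  have B': "B \<in> carrier_mat (Suc (Suc (2 * l))) (Suc (Suc (2 * l)))" using B_carrier m by simp
  have ij': "i < Suc (Suc (2 * l))" "j < Suc (Suc (2 * l))" using ij m by auto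
  have "coeff (pfaff_adjugate B $$ (i, j)) s = 0"
  proof (cases "i = j")
    case True
    then show ?thesis using ij B_carrier by (simp add: pfaff_adjugate_diag)
  next
    case False
    \<comment> \<open>The minors of A and J written through \<open>skip_two\<close>, which exhibit
      the minor of B as linear in t.\<close>
    let ?A' = "mat (2 * l) (2 * l) (\<lambda>(a, b). A $$ (skip_two j i a, skip_two j i b))"
    let ?J' = "mat (2 * l) (2 * l) (\<lambda>(a, b). J_mat m $$ (skip_two j i a, skip_two j i b))"
    have "coeff (pfaffian (remove_two B j i)) s = 0"
    proof (rule pfaffian_linear_top(2)[where A = ?A' and J = ?J' and m = l])
      show "dim_row (remove_two B j i) = 2 * l"
        using remove_two_dim[OF B' _ ij'(2,1)] False by auto
      show "l < s" using assms m by simp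
      fix a b assume ab: "a < 2 * l" "b < 2 * l"
      have lt: "skip_two j i a < 2 * m" "skip_two j i b < 2 * m"
        using skip_two_less[OF ab(1), of j i] skip_two_less[OF ab(2), of j i] m by auto
      have "remove_two B j i $$ (a, b) = B $$ (skip_two j i a, skip_two j i b)"
        by (rule remove_two_index[OF B' _ ij'(2,1) ab]) (use False in simp)
      then show "remove_two B j i $$ (a, b) = [:?A' $$ (a, b), ?J' $$ (a, b):]"
        using ab B_index[OF lt] by simp
    qed simp
    then show ?thesis
      using False by (simp add: pfaff_adjugate_index[OF B_carrier ij(2,1)] minus_one_power_iff)
  qed
  then show "padj_coeff A m s $$ (i, j) = 0\<^sub>m (2 * m) (2 * m) $$ (i, j)"
    using ij by (simp add: padj_coeff_index)
qed (use padj_coeff_carrier in auto)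

lemma padj_coeff_0: "padj_coeff A m 0 = pfaff_adjugate A"
proof (rule eq_matI)
  fix i j assume "i < dim_row (pfaff_adjugate A)" "j < dim_col (pfaff_adjugate A)"
  then have ij: "i < 2 * m" "j < 2 * m" using A by (auto simp: pfaff_adjugate_def)
  obtain l where m: "2 * m = Suc (Suc (2 * l))" using ij by (cases m) auto
  have "coeff (pfaff_adjugate B $$ (i, j)) 0 = pfaff_adjugate A $$ (i, j)"
  proof (cases "i = j")
    case True
    then show ?thesis using ij A B_carrier by (simp add: pfaff_adjugate_diag)
  next
    case False
    have dA: "remove_two A j i \<in> carrier_mat (2 * l) (2 * l)"
      and dB: "remove_two B j i \<in> carrier_mat (2 * l) (2 * l)"
      using remove_two_dim[OF A[unfolded m]] remove_two_dim[OF B_carrier[unfolded m]] ij False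
      unfolding m by auto
    have "coeff (pfaffian (remove_two B j i)) 0 = pfaffian (remove_two A j i)"
    proof (rule coeff_0_pfaffian)
      fix a b assume "a < dim_row (remove_two B j i)" "b < dim_row (remove_two B j i)"
      then have ab: "a < 2 * l" "b < 2 * l" using dB by auto
      have lt: "skip_two j i a < 2 * m" "skip_two j i b < 2 * m"
        using skip_two_less[OF ab(1), of j i] skip_two_less[OF ab(2), of j i] m by auto
      have "remove_two B j i $$ (a, b) = B $$ (skip_two j i a, skip_two j i b)"
        by (rule remove_two_index[OF B_carrier[unfolded m] _ _ _ ab]) (use False ij m in simp_all)
      moreover have "remove_two A j i $$ (a, b) = A $$ (skip_two j i a, skip_two j i b)"
        by (rule remove_two_index[OF A[unfolded m] _ _ _ ab]) (use False ij m in simp_all)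
      ultimately show "remove_two A j i $$ (a, b) = coeff (remove_two B j i $$ (a, b)) 0"
        using B_index[OF lt] by simp
    qed (use dA dB in simp)
    then show ?thesis
      using False by (simp add: pfaff_adjugate_index[OF B_carrier ij(2,1)]
          pfaff_adjugate_index[OF A ij(2,1)] minus_one_power_iff)
  qed
  then show "padj_coeff A m 0 $$ (i, j) = pfaff_adjugate A $$ (i, j)"
    using ij by (simp add: padj_coeff_index)
qed (use padj_coeff_carrier A in \<open>auto simp: pfaff_adjugate_def\<close>)

lemma J_mat_mult_J_mat_mult:
  assumes "X \<in> carrier_mat (2 * m) (2 * m)"
  shows "J_mat m * (J_mat m * X) = - (X :: 'a mat)"
proof -
  have "J_mat m * (J_mat m * X) = (J_mat m * J_mat m) * X"
    by (rule assoc_mult_mat[symmetric, OF J_mat_carrier J_mat_carrier assms])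
  then show ?thesis using assms by (simp add: J_mat_mult_J_mat)
qed

text \<open>Origin of the initial value -J: at s = m the relation reduces to J M = I, and -J is the
  inverse of J.\<close>

lemma padj_coeff_last:
  assumes "1 \<le> m"
  shows "padj_coeff A m (m - 1) = - J_mat m"
proof -
  have "1 \<cdot>\<^sub>m 1\<^sub>m (2 * m) = (1\<^sub>m (2 * m) :: 'a mat)" by (rule eq_matI) auto
  then have "J_mat m * padj_coeff A m (m - 1) = 1\<^sub>m (2 * m)"
    using padj_coeff_relation[of m] padj_coeff_eq_0[of m] pf_coeff_top(1) assms A
      padj_coeff_carrier[of "m - 1"] J_mat_carrier[of m, where 'a = 'a]
    by simp
  then have "- padj_coeff A m (m - 1) = J_mat m * 1\<^sub>m (2 * m)"
    using J_mat_mult_J_mat_mult[OF padj_coeff_carrier, of "m - 1"] by simp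
  then have "- padj_coeff A m (m - 1) = J_mat m"
    using J_mat_carrier[of m, where 'a = 'a] by simp
  then show ?thesis by (metis uminus_uminus_mat)
qed

text \<open>Multiply the relation at s + 1 by J from the left and solve for the term in which J^2 =
  -I appears.\<close>

lemma padj_coeff_step:
  "padj_coeff A m s = J_mat m * A * padj_coeff A m (Suc s) - pf_coeff A m (Suc s) \<cdot>\<^sub>m J_mat m"
proof -
  note J = J_mat_carrier[of m, where 'a = 'a]
  let ?X = "A * padj_coeff A m (Suc s)" and ?Y = "J_mat m * padj_coeff A m s"
  have X: "?X \<in> carrier_mat (2 * m) (2 * m)" using A padj_coeff_carrier by auto
  have Y: "?Y \<in> carrier_mat (2 * m) (2 * m)" using J padj_coeff_carrier by auto
  have "J_mat m * (?X + ?Y) = J_mat m * (pf_coeff A m (Suc s) \<cdot>\<^sub>m 1\<^sub>m (2 * m))"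
    using padj_coeff_relation[of "Suc s"] by simp
  also have "\<dots> = pf_coeff A m (Suc s) \<cdot>\<^sub>m J_mat m"
    using J by (simp add: mult_smult_distrib[OF J one_carrier_mat])
  also have "J_mat m * (?X + ?Y) = J_mat m * ?X + - padj_coeff A m s"
    using mult_add_distrib_mat[OF J X Y] J_mat_mult_J_mat_mult[OF padj_coeff_carrier] by simp
  also have "J_mat m * ?X = J_mat m * A * padj_coeff A m (Suc s)"
    by (rule assoc_mult_mat[symmetric, OF J A padj_coeff_carrier])
  finally have eq: "J_mat m * A * padj_coeff A m (Suc s) + - padj_coeff A m s = pf_coeff A m (Suc s) \<cdot>\<^sub>m J_mat m" .
  let ?Z = "J_mat m * A * padj_coeff A m (Suc s)"
  have Z: "?Z \<in> carrier_mat (2 * m) (2 * m)" using A J padj_coeff_carrier[of "Suc s"] by auto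
  show ?thesis
    unfolding eq[symmetric]
    by (rule eq_matI) (use Z padj_coeff_carrier[of s] in auto)
qed

end

lemma pfaffian_recursion:
  fixes A :: "'a::comm_rat_algebra mat"
  assumes A: "A \<in> carrier_mat (2 * m) (2 * m)" and sk: "skew_symmetric A" and m: "1 \<le> m"
    and N1: "N 1 = - J_mat m"
    and c: "\<And>k. k \<in> {1..m} \<Longrightarrow> c k = (1 / of_nat (2 * k)) *\<^sub>Q mat_trace (A * N k)"
    and N: "\<And>k. k \<in> {1..m - 1} \<Longrightarrow> N (k + 1) = J_mat m * A * N k - c k \<cdot>\<^sub>m J_mat m"
    and k: "k \<in> {1..m}"
  shows "N k = padj_coeff A m (m - k)" "c k = pf_coeff A m (m - k)"
proof -
  \<comment> \<open>Since \<open>c k\<close> depends only on \<open>N k\<close>, it is settled first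
    and is then available within the induction on k.\<close>
  have ck: "c k = pf_coeff A m (m - k)" if "k \<in> {1..m}" "N k = padj_coeff A m (m - k)" for k
  proof -
    have "mat_trace (A * N k) = of_nat (2 * k) * pf_coeff A m (m - k)"
      using trace_A_padj_coeff[OF A sk, of "m - k"] that by simp
    then show ?thesis using c[OF that(1)] scaleQ_inverse_of_nat[of "2 * k"] that(1) by simp
  qed
  have "k \<in> {1..m} \<longrightarrow> N k = padj_coeff A m (m - k)" for k
  proof (induction k)
    case (Suc k)
    show ?case
    proof
      assume Sk: "Suc k \<in> {1..m}"
      show "N (Suc k) = padj_coeff A m (m - Suc k)"
      proof (cases "k = 0")
        case True
        then show ?thesis using N1 padj_coeff_last[OF A sk m] by simp
      next
        case False
        \<comment> \<open>The index of the coefficient runs downwards as k grows;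
          \<open>Suc k\<close> being at most m keeps the subtraction exact.\<close>
        with Sk have k: "k \<in> {1..m}" "k \<in> {1..m - 1}" "Suc (m - Suc k) = m - k" by auto
        then have "N k = padj_coeff A m (m - k)" using Suc by simp
        then show ?thesis
          using N[OF k(2)] ck[OF k(1)] padj_coeff_step[OF A sk, of "m - Suc k"] k(3) by simp
      qed
    qed
  qed simp
  then show "N k = padj_coeff A m (m - k)" using k by blast
  then show "c k = pf_coeff A m (m - k)" by (rule ck[OF k])
qed

lemma pfaffian_from_recursion:
  fixes A :: "'a::comm_rat_algebra mat"
  assumes A: "A \<in> carrier_mat (2 * m) (2 * m)" and sk: "skew_symmetric A" and m: "1 \<le> m"
    and c0: "c 0 = 1" and N1: "N 1 = - J_mat m"
    and c: "\<And>k. k \<in> {1..m} \<Longrightarrow> c k = (1 / of_nat (2 * k)) *\<^sub>Q mat_trace (A * N k)"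
    and N: "\<And>k. k \<in> {1..m - 1} \<Longrightarrow> N (k + 1) = J_mat m * A * N k - c k \<cdot>\<^sub>m J_mat m"
  shows "pfaffian ([:0, 1:] \<cdot>\<^sub>m map_mat (\<lambda>a. [:a:]) (J_mat m) + map_mat (\<lambda>a. [:a:]) A)
          = (\<Sum>j=0..m. monom (c (m - j)) j)"
    and "c m = pfaffian A" and "N m = pfaff_adjugate A" and "A * N m = pfaffian A \<cdot>\<^sub>m 1\<^sub>m (2 * m)"
proof -
  note rec = pfaffian_recursion[where N = N and c = c, OF A sk m N1 c N]
  have c_all: "c (m - j) = pf_coeff A m j" if "j \<le> m" for j
  \<comment> \<open>The value \<open>c 0\<close> is outside the range of the recursion and is
    matched with the leading coefficient pf(J) = 1.\<close>
  proof (cases "j = m")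
    case True
    then show ?thesis using c0 pf_coeff_top(1)[OF A sk] by simp
  next
    case False
    then show ?thesis using rec(2)[of "m - j"] that by simp
  qed
  show "pfaffian ([:0, 1:] \<cdot>\<^sub>m map_mat (\<lambda>a. [:a:]) (J_mat m) + map_mat (\<lambda>a. [:a:]) A)
          = (\<Sum>j=0..m. monom (c (m - j)) j)"
  proof (rule poly_eqI)
    fix s
    have "coeff (\<Sum>j=0..m. monom (c (m - j)) j) s = (if s \<le> m then c (m - s) else 0)"
      by (simp add: coeff_sum coeff_monom)
    also have "\<dots> = pf_coeff A m s" using c_all[of s] pf_coeff_top(2)[OF A sk, of s] by auto
    finally show "coeff (pfaffian ([:0, 1:] \<cdot>\<^sub>m map_mat (\<lambda>a. [:a:]) (J_mat m) + map_mat (\<lambda>a. [:a:]) A)) s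
          = coeff (\<Sum>j=0..m. monom (c (m - j)) j) s"
      by (simp add: pf_coeff_def)
  qed
  show "c m = pfaffian A" using c_all[of 0] pf_coeff_0[OF A sk] by simp
  show Nm: "N m = pfaff_adjugate A" using rec(1)[of m] m padj_coeff_0[OF A sk] by simp
  show "A * N m = pfaffian A \<cdot>\<^sub>m 1\<^sub>m (2 * m)" unfolding Nm by (rule mult_pfaff_adjugate[OF A sk])
qed

section \<open>Correctness and cost of the program\<close>

lemma exec_Nil [simp]: "exec [] s = s"
  and exec_Cons [simp]: "exec (i # p) s = exec p (exec_instr i s)"
  and exec_append [simp]: "exec (p @ q) s = exec q (exec p s)"
  by (simp_all add: exec_def)

lemma cost_Nil [simp]: "cost [] = 0"
  and cost_Cons [simp]: "cost (i # p) = instr_cost i + cost p"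
  and cost_append [simp]: "cost (p @ q) = cost p + cost q"
  by (simp_all add: cost_def)

lemma exec_map_instr:
  assumes "inj f"
  shows "exec (map (map_instr id f) p) s (f v) = exec p (s \<circ> f) v"
proof (induction p arbitrary: s)
  case (Cons i p)
  have "exec_instr (map_instr id f i) s \<circ> f = exec_instr i (s \<circ> f)"
    using assms by (cases i) (auto simp: fun_eq_iff inj_eq)
  then show ?case by (simp only: list.map exec_Cons Cons.IH)
qed simp

lemma exec_map_instr_other:
  assumes "r \<notin> range f"
  shows "exec (map (map_instr id f) p) s r = s r"
proof (induction p arbitrary: s)
  case (Cons i p)
  have "exec_instr (map_instr id f i) s r = s r" using assms by (cases i) auto
  then show ?case by (simp only: list.map exec_Cons Cons.IH)
qed simp

lemma cost_map_instr: "cost (map (map_instr id f) p) = cost p"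
proof (induction p)
  case (Cons i p)
  then show ?case by (cases i) auto
qed simp

lemma for_entries_eq:
  "for_entries n f = concat (map (\<lambda>(i, j). f i j) (List.product [0..<n] [0..<n]))"
  by (simp add: for_entries_def product_concat_map map_concat o_def)

text \<open>A loop rule: \<open>Inv\<close> is kept by every iteration, \<open>Q x\<close> is
  established by iteration x and survives all others. A repeated x merely establishes it
  again.\<close>

lemma exec_concat_invariant:
  assumes "Inv s"
    and "\<And>x s. x \<in> set xs \<Longrightarrow> Inv s \<Longrightarrow> Inv (exec (g x) s) \<and> Q x (exec (g x) s)"
    and "\<And>x y s. x \<in> set xs \<Longrightarrow> y \<in> set xs \<Longrightarrow> x \<noteq> y \<Longrightarrow> Inv s \<Longrightarrow> Q x s \<Longrightarrow> Q x (exec (g y) s)"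
  shows "Inv (exec (concat (map g xs)) s) \<and> (\<forall>x\<in>set xs. Q x (exec (concat (map g xs)) s))"
  using assms(2,3)
proof (induction xs rule: rev_induct)
  case Nil
  then show ?case using assms(1) by simp
next
  case (snoc y xs)
  let ?t = "exec (concat (map g xs)) s"
  have IH: "Inv ?t" "\<And>x. x \<in> set xs \<Longrightarrow> Q x ?t"
    using snoc.IH snoc.prems by auto
  have "Q x (exec (g y) ?t)" if "x \<in> set (xs @ [y])" for x
    using snoc.prems[of x] snoc.prems(1)[of y] IH that by (cases "x = y") auto
  then show ?case using snoc.prems(1)[of y] IH by simp
qed

lemma exec_for_entries:
  assumes "Inv s"
    and "\<And>i j s. i < n \<Longrightarrow> j < n \<Longrightarrow> Inv s \<Longrightarrow> Inv (exec (f i j) s) \<and> Q i j (exec (f i j) s)"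
    and "\<And>i j i' j' s. i < n \<Longrightarrow> j < n \<Longrightarrow> i' < n \<Longrightarrow> j' < n \<Longrightarrow> (i, j) \<noteq> (i', j') \<Longrightarrow>
          Inv s \<Longrightarrow> Q i j s \<Longrightarrow> Q i j (exec (f i' j') s)"
  shows "Inv (exec (for_entries n f) s) \<and> (\<forall>i<n. \<forall>j<n. Q i j (exec (for_entries n f) s))"
proof -
  have "Inv (exec (for_entries n f) s) \<and>
      (\<forall>x\<in>set (List.product [0..<n] [0..<n]). case_prod Q x (exec (for_entries n f) s))"
    unfolding for_entries_eq
  proof (rule exec_concat_invariant)
    show "Inv s" by (rule assms(1))
  next
    fix x t assume "x \<in> set (List.product [0..<n] [0..<n])" "Inv t"
    then show "Inv (exec (case x of (i, j) \<Rightarrow> f i j) t) \<and> case_prod Q x (exec (case x of (i, j) \<Rightarrow> f i j) t)"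
      using assms(2) by auto
  next
    fix x y t
    assume "x \<in> set (List.product [0..<n] [0..<n])" "y \<in> set (List.product [0..<n] [0..<n])"
      "x \<noteq> y" "Inv t" "case_prod Q x t"
    then show "case_prod Q x (exec (case y of (i, j) \<Rightarrow> f i j) t)"
      using assms(3)[of "fst x" "snd x" "fst y" "snd y" t] by (auto simp: case_prod_unfold)
  qed
  then show ?thesis by auto
qed

lemma cost_for_entries:
  assumes "\<And>i j. cost (f i j) = c"
  shows "cost (for_entries n f) = n * n * c"
proof -
  have "cost (concat (map (\<lambda>(i, j). f i j) xs)) = length xs * c" for xs
    by (induction xs) (auto simp: assms)
  then show ?thesis by (simp add: for_entries_eq)
qed

lemma set_for_entries: "set (for_entries n f) = (\<Union>i<n. \<Union>j<n. set (f i j))"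
  by (fastforce simp: for_entries_eq)

lemma call_product:
  assumes p: "computes_product n p"
    and B: "B \<in> carrier_mat n n" and C: "C \<in> carrier_mat n n"
    and X: "holds s X B" and Y: "holds s Y C"
    and nX: "\<And>i j. X i j \<notin> range RegMul" and nY: "\<And>i j. Y i j \<notin> range RegMul"
    and nZ: "\<And>i j. Z i j \<notin> range RegMul" and iZ: "\<And>i j i' j'. Z i j = Z i' j' \<Longrightarrow> i = i' \<and> j = j'"
  shows "holds (exec (call_product p n X Y Z) s) Z (B * C)"
    and "\<And>r. r \<notin> range RegMul \<Longrightarrow> (\<And>i j. r \<noteq> Z i j) \<Longrightarrow> exec (call_product p n X Y Z) s r = s r"
proof -
  let ?f1 = "\<lambda>i j. [Copy (RegMul (LeftIn i j)) (X i j), Copy (RegMul (RightIn i j)) (Y i j)]"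
  let ?f3 = "\<lambda>i j. [Copy (Z i j) (RegMul (ProdOut i j))]"
  define s1 where "s1 = exec (for_entries n ?f1) s"
  define s2 where "s2 = exec (map (map_instr id RegMul) p) s1"
  define s3 where "s3 = exec (for_entries n ?f3) s2"
  have e: "exec (call_product p n X Y Z) s = s3"
    by (simp add: call_product_def s1_def s2_def s3_def)
  let ?I1 = "\<lambda>t. \<forall>r. r \<notin> range RegMul \<longrightarrow> t r = s r"
  let ?Q1 = "\<lambda>i j t. t (RegMul (LeftIn i j)) = B $$ (i, j) \<and> t (RegMul (RightIn i j)) = C $$ (i, j)"
  have XB: "s (X i j) = B $$ (i, j)" "s (Y i j) = C $$ (i, j)" if "i < n" "j < n" for i j
    using X Y B C that by (auto simp: holds_def)
  have ph1: "?I1 s1 \<and> (\<forall>i<n. \<forall>j<n. ?Q1 i j s1)"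
    unfolding s1_def
  proof (rule exec_for_entries[where Inv = ?I1 and Q = ?Q1])
    fix i j t assume ij: "i < n" "j < n" and I: "?I1 t"
    then have "t (X i j) = B $$ (i, j)" "t (Y i j) = C $$ (i, j)" using XB nX nY by auto
    moreover have "X i j \<noteq> RegMul r" "Y i j \<noteq> RegMul r" for r using nX nY by blast+
    ultimately show "?I1 (exec (?f1 i j) t) \<and> ?Q1 i j (exec (?f1 i j) t)" using I by auto
  qed auto
  have inj: "inj RegMul" by (simp add: inj_def)
  have "holds (s1 \<circ> RegMul) LeftIn B" "holds (s1 \<circ> RegMul) RightIn C"
    using ph1 B C by (auto simp: holds_def)
  then have "holds (exec p (s1 \<circ> RegMul)) ProdOut (B * C)"
    using p B C by (auto simp: computes_product_def)
  then have s2P: "s2 (RegMul (ProdOut i j)) = (B * C) $$ (i, j)" if "i < n" "j < n" for i j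
    using B C that by (auto simp: holds_def s2_def exec_map_instr[OF inj])
  have s2o: "s2 r = s r" if "r \<notin> range RegMul" for r
    using ph1 that by (simp add: s2_def exec_map_instr_other)
  let ?I3 = "\<lambda>t. \<forall>r. (\<forall>i j. r \<noteq> Z i j) \<longrightarrow> t r = s2 r"
  let ?Q3 = "\<lambda>i j t. t (Z i j) = (B * C) $$ (i, j)"
  have ph3: "?I3 s3 \<and> (\<forall>i<n. \<forall>j<n. ?Q3 i j s3)"
    unfolding s3_def
  proof (rule exec_for_entries[where Inv = ?I3 and Q = ?Q3])
    fix i j t assume ij: "i < n" "j < n" and I: "?I3 t"
    have "RegMul (ProdOut i j) \<noteq> Z i' j'" for i' j' by (metis nZ rangeI)
    then have "t (RegMul (ProdOut i j)) = (B * C) $$ (i, j)" using I s2P[OF ij] by simp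
    then show "?I3 (exec (?f3 i j) t) \<and> ?Q3 i j (exec (?f3 i j) t)" using I by simp
  qed (use iZ in auto)
  show "holds (exec (call_product p n X Y Z) s) Z (B * C)"
    unfolding e using ph3 B C by (simp add: holds_def)
  show "exec (call_product p n X Y Z) s r = s r" if "r \<notin> range RegMul" "\<And>i j. r \<noteq> Z i j" for r
    unfolding e using ph3 s2o that by simp
qed

lemma exec_accumulate:
  assumes "\<And>i. v i \<noteq> t"
  shows "exec (map (\<lambda>i. Add t t (v i)) [0..<n]) s = s(t := s t + (\<Sum>i<n. s (v i)))"
  by (induction n) (use assms in \<open>auto simp: add.assoc\<close>)

lemma coeff_step:
  assumes p: "computes_product n p"
    and B: "B \<in> carrier_mat n n" and C: "C \<in> carrier_mat n n"
    and hA: "holds s RegA B" and hN: "holds s RegN C"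
  shows "holds (exec (coeff_step p n k) s) RegAN (B * C)"
    and "exec (coeff_step p n k) s (RegC k) = (1 / of_nat (2 * k)) *\<^sub>Q mat_trace (B * C)"
    and "\<And>i j. exec (coeff_step p n k) s (RegA i j) = s (RegA i j)"
    and "\<And>i j. exec (coeff_step p n k) s (RegJ i j) = s (RegJ i j)"
proof -
  define s1 where "s1 = exec (call_product p n RegA RegN RegAN) s"
  have h: "holds s1 RegAN (B * C)"
    unfolding s1_def by (rule call_product(1)[OF p B C hA hN]) auto
  have o: "s1 r = s r" if "\<forall>x. r \<noteq> RegMul x" "\<forall>i j. r \<noteq> RegAN i j" for r
    unfolding s1_def by (rule call_product(2)[OF p B C hA hN]) (use that in auto)
  have e: "exec (coeff_step p n k) s =
      s1(RegT := (\<Sum>i<n. s1 (RegAN i i)), RegC k := (1 / of_int (2 * int k)) *\<^sub>Q (\<Sum>i<n. s1 (RegAN i i)))"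
    by (simp add: coeff_step_def s1_def[symmetric] exec_accumulate)
  have "(\<Sum>i<n. s1 (RegAN i i)) = mat_trace (B * C)"
    using h B C by (simp add: mat_trace_def holds_def)
  then show "exec (coeff_step p n k) s (RegC k) = (1 / of_nat (2 * k)) *\<^sub>Q mat_trace (B * C)"
    by (simp add: e)
  show "holds (exec (coeff_step p n k) s) RegAN (B * C)" using h by (simp add: e holds_def)
  show "exec (coeff_step p n k) s (RegA i j) = s (RegA i j)" for i j by (simp add: e o)
  show "exec (coeff_step p n k) s (RegJ i j) = s (RegJ i j)" for i j by (simp add: e o)
qed

text \<open>\<open>RegN\<close> can be overwritten entry by entry because the update reads only
  \<open>RegJAN\<close>, \<open>RegJ\<close>, \<open>RegC\<close> and the scratch register
  \<open>RegT\<close>.\<close>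

lemma matrix_step:
  assumes p: "computes_product n p"
    and B: "B \<in> carrier_mat n n" and C: "C \<in> carrier_mat n n"
    and hJ: "holds s RegJ B" and hAN: "holds s RegAN C"
  shows "holds (exec (matrix_step p n k) s) RegN (B * C - s (RegC k) \<cdot>\<^sub>m B)"
    and "\<And>l. exec (matrix_step p n k) s (RegC l) = s (RegC l)"
    and "\<And>i j. exec (matrix_step p n k) s (RegA i j) = s (RegA i j)"
    and "\<And>i j. exec (matrix_step p n k) s (RegJ i j) = s (RegJ i j)"
proof -
  define s1 where "s1 = exec (call_product p n RegJ RegAN RegJAN) s"
  let ?f = "\<lambda>i j. [Mul RegT (RegC k) (RegJ i j), Sub (RegN i j) (RegJAN i j) RegT]"
  have h: "holds s1 RegJAN (B * C)"
    unfolding s1_def by (rule call_product(1)[OF p B C hJ hAN]) auto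
  have o: "s1 r = s r" if "\<forall>x. r \<noteq> RegMul x" "\<forall>i j. r \<noteq> RegJAN i j" for r
    unfolding s1_def by (rule call_product(2)[OF p B C hJ hAN]) (use that in auto)
  have e: "exec (matrix_step p n k) s = exec (for_entries n ?f) s1"
    by (simp add: matrix_step_def s1_def)
  let ?I = "\<lambda>t. \<forall>r. r \<noteq> RegT \<longrightarrow> (\<forall>i j. r \<noteq> RegN i j) \<longrightarrow> t r = s1 r"
  let ?Q = "\<lambda>i j t. t (RegN i j) = (B * C - s (RegC k) \<cdot>\<^sub>m B) $$ (i, j)"
  have ph: "?I (exec (for_entries n ?f) s1) \<and> (\<forall>i<n. \<forall>j<n. ?Q i j (exec (for_entries n ?f) s1))"
  proof (rule exec_for_entries[where Inv = ?I and Q = ?Q])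
    fix i j t assume ij: "i < n" "j < n" and I: "?I t"
    have "t (RegJAN i j) = (B * C) $$ (i, j)" using I h B C ij by (simp add: holds_def)
    moreover have "t (RegJ i j) = B $$ (i, j)" using I o hJ B ij by (simp add: holds_def)
    moreover have "t (RegC k) = s (RegC k)" using I o by simp
    ultimately show "?I (exec (?f i j) t) \<and> ?Q i j (exec (?f i j) t)"
      using I B C ij by simp
  qed auto
  show "holds (exec (matrix_step p n k) s) RegN (B * C - s (RegC k) \<cdot>\<^sub>m B)"
    unfolding e using ph B C by (simp add: holds_def)
  show "exec (matrix_step p n k) s (RegC l) = s (RegC l)" for l unfolding e using ph o by simp
  show "exec (matrix_step p n k) s (RegA i j) = s (RegA i j)" for i j unfolding e using ph o by simp
  show "exec (matrix_step p n k) s (RegJ i j) = s (RegJ i j)" for i j unfolding e using ph o by simp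
qed

text \<open>The recursion of the theorem, shifted by one: \<open>rec_N A m k\<close> is \<open>N\<^sub>k\<^sub>+\<^sub>1\<close>.\<close>
primrec rec_N :: "'a::comm_rat_algebra mat \<Rightarrow> nat \<Rightarrow> nat \<Rightarrow> 'a mat" where
  "rec_N A m 0 = - J_mat m"
| "rec_N A m (Suc k) = J_mat m * A * rec_N A m k
     - ((1 / of_nat (2 * Suc k)) *\<^sub>Q mat_trace (A * rec_N A m k)) \<cdot>\<^sub>m J_mat m"

lemma rec_N_carrier:
  assumes "A \<in> carrier_mat (2 * m) (2 * m)"
  shows "rec_N A m k \<in> carrier_mat (2 * m) (2 * m)"
proof -
  have "dim_row (J_mat m :: 'a mat) = 2 * m" "dim_col (J_mat m :: 'a mat) = 2 * m"
    using J_mat_carrier[of m, where 'a = 'a] by auto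
  then show ?thesis by (cases k) (auto intro!: carrier_matI)
qed

lemma pfaffian_prog_correct:
  fixes A :: "'a::comm_rat_algebra mat"
  assumes p: "computes_product (2 * m) p" and m: "1 \<le> m"
    and A: "A \<in> carrier_mat (2 * m) (2 * m)" and sk: "skew_symmetric A" and hA: "holds s RegA A"
  shows "exec (pfaffian_prog p m) s (RegC m) = pfaffian A"
proof -
  let ?n = "2 * m"
  let ?J = "J_mat m :: 'a mat"
  note J = J_mat_carrier[of m, where 'a = 'a]
  \<comment> \<open>The \<open>k - 1\<close> undoes the shift in \<open>rec_N\<close>; k = 0 is
    treated separately.\<close>
  define c where "c k = (if k = 0 then 1 else (1 / of_nat (2 * k)) *\<^sub>Q mat_trace (A * rec_N A m (k - 1)))" for k
  have cm: "c m = pfaffian A"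
  proof (rule pfaffian_from_recursion(2)[OF A sk m, where N = "\<lambda>k. rec_N A m (k - 1)"])
    fix k assume "k \<in> {1..m - 1}"
    then obtain l where "k = Suc l" by (cases k) auto
    then show "rec_N A m (k + 1 - 1) = ?J * A * rec_N A m (k - 1) - c k \<cdot>\<^sub>m ?J"
      by (simp add: c_def)
  qed (auto simp: c_def)
  let ?f0 = "\<lambda>i j. [Const (RegJ i j) (?J $$ (i, j)), Const (RegN i j) ((- ?J) $$ (i, j))]"
  define s0 where "s0 = exec (for_entries ?n ?f0 @ [Const (RegC 0) 1]) s"
  define body where "body k = coeff_step p ?n k @ (if k < m then matrix_step p ?n k else [])" for k
  define st where "st k = exec (concat (map body [1..<k + 1])) s0" for k
  have e: "exec (pfaffian_prog p m) s = st m"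
    by (simp add: pfaffian_prog_def st_def s0_def body_def[abs_def] del: upt_Suc)
  let ?I = "\<lambda>t. \<forall>i j. t (RegA i j) = s (RegA i j)"
  let ?Q = "\<lambda>i j t. t (RegJ i j) = ?J $$ (i, j) \<and> t (RegN i j) = (- ?J) $$ (i, j)"
  have "?I (exec (for_entries ?n ?f0) s) \<and> (\<forall>i<?n. \<forall>j<?n. ?Q i j (exec (for_entries ?n ?f0) s))"
    by (rule exec_for_entries[where Inv = ?I and Q = ?Q]) auto
  then have init: "holds s0 RegA A" "holds s0 RegJ ?J" "holds s0 RegN (- ?J)"
    using J hA by (auto simp: s0_def holds_def)
  \<comment> \<open>The invariant after k rounds. It mentions \<open>RegN\<close> only for k < m
    because the final round omits \<open>matrix_step\<close>.\<close>
  have "k \<le> m \<longrightarrow> holds (st k) RegA A \<and> holds (st k) RegJ ?J \<and>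
      (k < m \<longrightarrow> holds (st k) RegN (rec_N A m k)) \<and> (1 \<le> k \<longrightarrow> st k (RegC k) = c k)" for k
  proof (induction k)
    case 0
    then show ?case using init by (simp add: st_def)
  next
    case (Suc k)
    show ?case
    proof
      assume Sk: "Suc k \<le> m"
      let ?N = "rec_N A m k"
      have IH: "holds (st k) RegA A" "holds (st k) RegJ ?J" "holds (st k) RegN ?N"
        using Suc Sk by auto
      note N = rec_N_carrier[OF A, of k]
      define t where "t = exec (coeff_step p ?n (Suc k)) (st k)"
      note cs = coeff_step[OF p A N IH(1,3), where k = "Suc k", folded t_def]
      have stS: "st (Suc k) = exec (if Suc k < m then matrix_step p ?n (Suc k) else []) t"
        by (simp add: st_def t_def body_def)
      have tA: "holds t RegA A" "holds t RegJ ?J"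
        using IH(1,2) cs(3,4) by (simp_all add: holds_def)
      have tc: "t (RegC (Suc k)) = c (Suc k)" using cs(2) by (simp add: c_def)
      show "holds (st (Suc k)) RegA A \<and> holds (st (Suc k)) RegJ ?J \<and>
        (Suc k < m \<longrightarrow> holds (st (Suc k)) RegN (rec_N A m (Suc k))) \<and>
        (1 \<le> Suc k \<longrightarrow> st (Suc k) (RegC (Suc k)) = c (Suc k))"
      proof (cases "Suc k < m")
        case True
        have AN: "A * ?N \<in> carrier_mat ?n ?n" using A N by auto
        note ms = matrix_step[OF p J AN tA(2) cs(1), where k = "Suc k"]
        \<comment> \<open>The program reuses the product A N from the trace computation, so a round
          needs two products; associativity reconciles this with (J A) N.\<close>
        have "?J * (A * ?N) - t (RegC (Suc k)) \<cdot>\<^sub>m ?J = rec_N A m (Suc k)"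
          using tc assoc_mult_mat[OF J A N] by (simp add: c_def)
        then show ?thesis
          unfolding stS using True ms tA tc by (simp add: holds_def)
      next
        case False
        then show ?thesis unfolding stS using tA tc by simp
      qed
    qed
  qed
  then have "st m (RegC m) = c m" using m by blast
  then show ?thesis using e cm by simp
qed

section \<open>Divisions and cost\<close>

lemma DivInt_map_instr:
  "DivInt x y d \<in> map_instr id f ` S \<Longrightarrow> \<exists>x y. DivInt x y d \<in> S"
proof (erule imageE)
  fix i assume "DivInt x y d = map_instr id f i" "i \<in> S"
  then show "\<exists>x y. DivInt x y d \<in> S" by (cases i) auto
qed

lemma DivInt_pfaffian_prog:
  assumes "DivInt x y d \<in> set (pfaffian_prog p m)"
  shows "(\<exists>k\<in>{1..m}. d = 2 * int k) \<or> DivInt x y d \<in> map_instr id RegMul ` set p"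
proof -
  have call: "DivInt x y d \<in> map_instr id RegMul ` set p" if "DivInt x y d \<in> set (call_product p n X Y Z)"
    for n X Y Z using that by (auto simp: call_product_def set_for_entries)
  show ?thesis
    using assms
    by (auto dest: call simp: pfaffian_prog_def coeff_step_def matrix_step_def set_for_entries
        simp del: upt_Suc split: if_splits)
qed

lemma no_zero_division_pfaffian_prog:
  assumes "no_zero_division p"
  shows "no_zero_division (pfaffian_prog p m)"
  unfolding no_zero_division_def
proof (intro allI notI)
  fix x y assume "DivInt x y 0 \<in> set (pfaffian_prog p m)"
  from DivInt_pfaffian_prog[OF this] show False
    using assms by (auto simp: no_zero_division_def dest!: DivInt_map_instr)
qed

text \<open>Per round, with n = 2m: two products, n additions and one division for the coefficient,
  one multiplication and one subtraction for each of the n^2 entries. The shorter last round is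
  bounded like the others.\<close>

lemma cost_pfaffian_prog:
  "cost (pfaffian_prog p m) \<le> m * (2 * cost p + 2 * m + 1 + 2 * (2 * m) * (2 * m))"
proof -
  have call: "cost (call_product p n X Y Z) = cost p" for n X Y Z
    by (simp add: call_product_def cost_map_instr cost_for_entries[where c = 0])
  have acc: "cost (map (\<lambda>i. Add RegT RegT (RegAN i i)) xs) = length xs" for xs
    by (induction xs) auto
  have cs: "cost (coeff_step p n k) = cost p + n + 1" for n k
    by (simp add: coeff_step_def call acc)
  have ms: "cost (matrix_step p n k) = cost p + n * n * 2" for n k
    by (simp add: matrix_step_def call cost_for_entries[where c = 2])
  let ?b = "\<lambda>k. coeff_step p (2 * m) k @ (if k < m then matrix_step p (2 * m) k else [])"
  have b: "cost (?b k) \<le> 2 * cost p + 2 * m + 1 + 2 * (2 * m) * (2 * m)" for k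
    by (simp add: cs ms)
  have "cost (concat (map ?b xs)) \<le> length xs * (2 * cost p + 2 * m + 1 + 2 * (2 * m) * (2 * m))" for xs
  proof (induction xs)
    case (Cons k xs)
    then show ?case using b[of k] by simp
  qed simp
  from this[of "[1..<m + 1]"] show ?thesis
    by (simp add: pfaffian_prog_def cost_for_entries[where c = 0] del: upt_Suc)
qed

lemma cost_pfaffian_prog_bigo:
  fixes \<beta> :: real
  assumes \<beta>: "2 \<le> \<beta>" and O: "(\<lambda>n. real (cost (mm n))) \<in> O(\<lambda>n. real n powr \<beta>)"
  shows "(\<lambda>m. real (cost (pfaffian_prog (mm (2 * m)) m))) \<in> O(\<lambda>m. real (2 * m) powr (\<beta> + 1))"
proof -
  obtain C where C: "C > 0" "\<forall>\<^sub>F n in at_top. norm (real (cost (mm n))) \<le> C * norm (real n powr \<beta>)"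
    using landau_o.bigE[OF O] by blast
  \<comment> \<open>The bound on \<open>mm\<close> holds for large n and is needed along the even
    numbers.\<close>
  have "filterlim (\<lambda>m::nat. 2 * m) at_top at_top"
    by (rule filterlim_subseq) (simp add: strict_mono_def)
  from eventually_compose_filterlim[OF C(2) this]
  have ev: "\<forall>\<^sub>F m in at_top. norm (real (cost (mm (2 * m)))) \<le> C * norm (real (2 * m) powr \<beta>)" .
  show ?thesis
  \<comment> \<open>2C comes from the two products, 4 from n + 1 + 2n^2 \<le> 4n^2 together with
    \<beta> \<ge> 2; the additional power of n bounds the m rounds.\<close>
  proof (rule landau_o.bigI[where c = "2 * C + 4"])
    show "\<forall>\<^sub>F m in at_top. norm (real (cost (pfaffian_prog (mm (2 * m)) m)))
        \<le> (2 * C + 4) * norm (real (2 * m) powr (\<beta> + 1))"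
      using ev eventually_ge_at_top[of 1]
    proof eventually_elim
      case (elim m)
      let ?n = "real (2 * m)"
      have n: "1 \<le> ?n" "real m \<le> ?n" using elim(2) by auto
      have sq: "?n * ?n \<le> ?n powr \<beta>"
        using powr_mono[OF \<beta> n(1)] n(1) by (simp add: power2_eq_square powr_numeral)
      have "?n \<le> ?n * ?n" using n(1) by (simp add: mult_le_cancel_left1)
      then have small: "?n + 1 + 2 * ?n * ?n \<le> 4 * (?n powr \<beta>)"
        using sq n(1) by linarith
      have "real (cost (pfaffian_prog (mm (2 * m)) m))
          \<le> real (m * (2 * cost (mm (2 * m)) + 2 * m + 1 + 2 * (2 * m) * (2 * m)))"
        using cost_pfaffian_prog by (rule of_nat_mono)
      also have "\<dots> = real m * (2 * real (cost (mm (2 * m))) + (?n + 1 + 2 * ?n * ?n))"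
        by (simp add: algebra_simps)
      also have "\<dots> \<le> ?n * (2 * (C * ?n powr \<beta>) + 4 * (?n powr \<beta>))"
        using elim(1) small n by (intro mult_mono add_mono) auto
      also have "\<dots> = (2 * C + 4) * ?n powr (\<beta> + 1)"
        using n(1) by (simp add: powr_add algebra_simps)
      finally show ?case by simp
    qed
  qed (use C(1) in simp)
qed

theorem mainTheorem1:
  shows
    "(\<forall>m\<ge>1. \<forall>A \<in> carrier_mat (2 * m) (2 * m).
        \<forall>(N :: nat \<Rightarrow> 'a::comm_rat_algebra mat) (c :: nat \<Rightarrow> 'a).
        skew_symmetric A \<and>
        c 0 = 1 \<and>
        N 1 = - J_mat m \<and>
        (\<forall>k\<in>{1..m}. c k = (1 / of_nat (2 * k)) *\<^sub>Q mat_trace (A * N k)) \<and>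
        (\<forall>k\<in>{1..m-1}. N (k + 1) = J_mat m * A * N k - c k \<cdot>\<^sub>m J_mat m)
        \<longrightarrow>
        pfaffian ([:0, 1:] \<cdot>\<^sub>m map_mat (\<lambda>a. [:a:]) (J_mat m) + map_mat (\<lambda>a. [:a:]) A)
          = (\<Sum>j=0..m. monom (c (m - j)) j) \<and>
        c m = pfaffian A \<and>
        N m = pfaff_adjugate A \<and>
        A * N m = pfaffian A \<cdot>\<^sub>m 1\<^sub>m (2 * m))
     \<and>
     (\<forall>(\<beta> :: real) (mm :: nat \<Rightarrow> ('a, mulreg) instr list).
        \<beta> \<ge> 2 \<and>
        (\<forall>n\<ge>1. computes_product n (mm n)) \<and>
        (\<lambda>n. real (cost (mm n))) \<in> O(\<lambda>n. real n powr \<beta>)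
        \<longrightarrow>
        (\<forall>m\<ge>1. computes_pfaffian m (pfaffian_prog (mm (2 * m)) m)) \<and>
        (\<lambda>m. real (cost (pfaffian_prog (mm (2 * m)) m)))
          \<in> O(\<lambda>m. real (2 * m) powr (\<beta> + 1)) \<and>
        (\<forall>m\<ge>1. \<forall>x y d. DivInt x y d \<in> set (pfaffian_prog (mm (2 * m)) m) \<longrightarrow>
           (\<exists>k\<in>{1..m}. d = 2 * int k) \<or>
           DivInt x y d \<in> map_instr id RegMul ` set (mm (2 * m))))"
proof (rule conjI)
  show "\<forall>m\<ge>1. \<forall>A \<in> carrier_mat (2 * m) (2 * m).
        \<forall>(N :: nat \<Rightarrow> 'a mat) (c :: nat \<Rightarrow> 'a).
        skew_symmetric A \<and>
        c 0 = 1 \<and>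
        N 1 = - J_mat m \<and>
        (\<forall>k\<in>{1..m}. c k = (1 / of_nat (2 * k)) *\<^sub>Q mat_trace (A * N k)) \<and>
        (\<forall>k\<in>{1..m-1}. N (k + 1) = J_mat m * A * N k - c k \<cdot>\<^sub>m J_mat m)
        \<longrightarrow>
        pfaffian ([:0, 1:] \<cdot>\<^sub>m map_mat (\<lambda>a. [:a:]) (J_mat m) + map_mat (\<lambda>a. [:a:]) A)
          = (\<Sum>j=0..m. monom (c (m - j)) j) \<and>
        c m = pfaffian A \<and>
        N m = pfaff_adjugate A \<and>
        A * N m = pfaffian A \<cdot>\<^sub>m 1\<^sub>m (2 * m)"
  proof (intro allI ballI impI, elim conjE)
    fix m and A :: "'a mat" and N :: "nat \<Rightarrow> 'a mat" and c :: "nat \<Rightarrow> 'a"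
    assume "1 \<le> m" "A \<in> carrier_mat (2 * m) (2 * m)" "skew_symmetric A" "c 0 = 1" "N 1 = - J_mat m"
      and c: "\<forall>k\<in>{1..m}. c k = (1 / of_nat (2 * k)) *\<^sub>Q mat_trace (A * N k)"
      and N: "\<forall>k\<in>{1..m-1}. N (k + 1) = J_mat m * A * N k - c k \<cdot>\<^sub>m J_mat m"
    note rec = pfaffian_from_recursion[where c = c and N = N and A = A and m = m,
        OF this(2,3,1,4,5) c[rule_format] N[rule_format]]
    show "pfaffian ([:0, 1:] \<cdot>\<^sub>m map_mat (\<lambda>a. [:a:]) (J_mat m) + map_mat (\<lambda>a. [:a:]) A)
          = (\<Sum>j=0..m. monom (c (m - j)) j) \<and>
        c m = pfaffian A \<and>
        N m = pfaff_adjugate A \<and>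
        A * N m = pfaffian A \<cdot>\<^sub>m 1\<^sub>m (2 * m)"
      using rec by blast
  qed
next
  show "\<forall>(\<beta> :: real) (mm :: nat \<Rightarrow> ('a, mulreg) instr list).
        \<beta> \<ge> 2 \<and>
        (\<forall>n\<ge>1. computes_product n (mm n)) \<and>
        (\<lambda>n. real (cost (mm n))) \<in> O(\<lambda>n. real n powr \<beta>)
        \<longrightarrow>
        (\<forall>m\<ge>1. computes_pfaffian m (pfaffian_prog (mm (2 * m)) m)) \<and>
        (\<lambda>m. real (cost (pfaffian_prog (mm (2 * m)) m)))
          \<in> O(\<lambda>m. real (2 * m) powr (\<beta> + 1)) \<and>
        (\<forall>m\<ge>1. \<forall>x y d. DivInt x y d \<in> set (pfaffian_prog (mm (2 * m)) m) \<longrightarrow>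
           (\<exists>k\<in>{1..m}. d = 2 * int k) \<or>
           DivInt x y d \<in> map_instr id RegMul ` set (mm (2 * m)))"
  proof (intro allI impI, elim conjE, intro conjI allI impI)
    fix \<beta> :: real and mm :: "nat \<Rightarrow> ('a, mulreg) instr list"
    assume "2 \<le> \<beta>" "(\<lambda>n. real (cost (mm n))) \<in> O(\<lambda>n. real n powr \<beta>)"
    then show "(\<lambda>m. real (cost (pfaffian_prog (mm (2 * m)) m))) \<in> O(\<lambda>m. real (2 * m) powr (\<beta> + 1))"
      by (rule cost_pfaffian_prog_bigo)
  next
    fix mm :: "nat \<Rightarrow> ('a, mulreg) instr list" and m :: nat
    assume mm: "\<forall>n\<ge>1. computes_product n (mm n)" and m: "1 \<le> m"
    have p: "computes_product (2 * m) (mm (2 * m))" using mm m by simp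
    then have "no_zero_division (mm (2 * m))" by (simp add: computes_product_def)
    then show "computes_pfaffian m (pfaffian_prog (mm (2 * m)) m)"
      using pfaffian_prog_correct[OF p m] no_zero_division_pfaffian_prog
      by (auto simp: computes_pfaffian_def)
  qed (rule DivInt_pfaffian_prog)
qed

end
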